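(* Let $a\in C^1(\mathbb T)$ be real valued with $0<\inf_{\mathbb T} a<\sup_{\mathbb T} a<\infty$, and let $\mathcal N(E)$ be the integrated density of states of the associated divergence-gradient Jacobi operators driven by the doubling map. Put $\kappa=\big(\int_{\mathbb T}a(x)^{-1}\,dx\big)^{-1}$. Then, as $E\to0^+$, $$\mathcal N(E)=\frac{1}{\pi\sqrt{\kappa}}\sqrt E+\mathcal O(E|\log E|),$$ where the implied constant may depend on $a$ but not on $E$.
   Context: $\mathbb T=\mathbb R/\mathbb Z$ with Lebesgue probability measure. For $x\in\mathbb T$, $n\in\mathbb Z_{\ge0}$ put $a_n(x)=a(2^n x \bmod 1)$. The operator $H(x)$ acts on $\ell^2(\mathbb Z_{\ge 0})$ by $$(H(x)u)_n=-a_{n+1}u_{n+1}+(a_n+a_{n+1})u_n-a_nu_{n-1},\quad n\ge0,\qquad u_{-1}=0.$$ Let $H_N(x)$ be the restriction of $H(x)$ to $[0,N-1]$ with Dirichlet boundary conditions $\psi_{-1}=\psi_N=0$ (an $N\times N$ symmetric matrix), with eigenvalues $E_1^N(x)\le\dots\le E_N^N(x)$. The integrated density of states is the limit, which exists and is constant for a.e. $x$, $$\mathcal N(E)=\lim_{N\to\infty}\frac1N\#\{j:E_j^N(x)\le E\}.$$ *)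

theory Defs
  imports
    "HOL-Analysis.Analysis"
    "HOL-Library.Landau_Symbols"
    "Jordan_Normal_Form.Char_Poly"
begin

text \<open>
  Functions on the circle are represented by 1-periodic functions on the reals, and points of
  the circle by their representatives in \<open>[0, 1)\<close>, which carries Lebesgue measure.
\<close>

definition coef :: "(real \<Rightarrow> real) \<Rightarrow> real \<Rightarrow> nat \<Rightarrow> real" where
  "coef a x n = a (frac (2 ^ n * x))"

definition jacobi :: "(real \<Rightarrow> real) \<Rightarrow> real \<Rightarrow> (nat \<Rightarrow> real) \<Rightarrow> nat \<Rightarrow> real" where
  "jacobi a x u n =
     - coef a x (n + 1) * u (n + 1) + (coef a x n + coef a x (n + 1)) * u n
     - coef a x n * (if n = 0 then 0 else u (n - 1))"

text \<open>
  The restriction to \<open>[0, N - 1]\<close> with Dirichlet conditions: entry \<open>(i, j)\<close> is the \<open>i\<close>-th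
  component of the operator applied to the \<open>j\<close>-th unit vector.  The Dirichlet condition at \<open>N\<close>
  leaves the diagonal entry at \<open>N - 1\<close> unchanged.
\<close>

definition jacobi_mat :: "(real \<Rightarrow> real) \<Rightarrow> real \<Rightarrow> nat \<Rightarrow> real mat" where
  "jacobi_mat a x N = mat N N (\<lambda>(i, j). jacobi a x (\<lambda>k. if k = j then 1 else 0) i)"

text \<open>
  Eigenvalues are counted with multiplicity.  The matrix is symmetric, so all \<open>N\<close> roots of its
  characteristic polynomial are real and algebraic and geometric multiplicities agree.
\<close>

definition eig_count :: "(real \<Rightarrow> real) \<Rightarrow> real \<Rightarrow> nat \<Rightarrow> real \<Rightarrow> nat" where
  "eig_count a x N E = size {# e \<in># proots (char_poly (jacobi_mat a x N)). e \<le> E #}"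

text \<open>
  \<open>F\<close> is the integrated density of states.  For each \<open>E\<close> this determines \<open>F E\<close> uniquely, as
  \<open>[0, 1)\<close> has positive measure; the exceptional null set may depend on \<open>E\<close>.
\<close>

definition is_IDS :: "(real \<Rightarrow> real) \<Rightarrow> (real \<Rightarrow> real) \<Rightarrow> bool" where
  "is_IDS a F \<longleftrightarrow>
     (\<forall>E. AE x in restrict_space lborel {0..<1}.
        (\<lambda>N. real (eig_count a x N E) / real N) \<longlonglongrightarrow> F E)"

end

theory Submission
  imports Defs
begin

text \<open>
  Write \<open>E = \<epsilon>\<^sup>2 \<kappa>\<close> and \<open>w = \<kappa> / a\<close>, so that \<open>w\<close> has mean one.  In the rescaled coordinates
  \<open>(a\<^sub>n (u\<^sub>n - u\<^sub>n\<^sub>-\<^sub>1), \<epsilon> \<kappa> u\<^sub>n\<^sub>-\<^sub>1)\<close> the eigenvalue equation rotates the Pruefer angle \<open>\<theta>\<^sub>n\<close> by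
  \<open>\<epsilon> (1 + (w\<^sub>n - 1) cos\<^sup>2 \<theta>\<^sub>n) + O(\<epsilon>\<^sup>2)\<close>, and by Sturm oscillation the number of eigenvalues up to \<open>E\<close>
  is the integer part of \<open>\<theta> / \<pi>\<close>.  Each step of the angle recursion is a perturbation of the identity of
  size \<open>\<epsilon>\<close>, whereas the doubling map stretches by two; hence \<open>\<theta>\<^sub>n\<close> is Lipschitz in \<open>x\<close> with constant
  \<open>O(\<epsilon> 2\<^sup>n)\<close>, that is, it varies by only \<open>O(\<epsilon>)\<close> on a dyadic interval of length \<open>2\<^sup>-\<^sup>n\<close>, over which
  \<open>w\<^sub>n - 1\<close> integrates to zero.  The expected rotation per step is therefore \<open>\<epsilon> + O(\<epsilon>\<^sup>2)\<close>, and dividing by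
  \<open>\<pi>\<close> gives the density of states with an error \<open>O(E)\<close>.
\<close>

section \<open>Interlacing roots of tridiagonal characteristic polynomials\<close>

text \<open>Serves twice: to factor the polynomials in \<open>tridiag_poly_roots\<close>, and to
  identify the characteristic polynomial of the Jacobi matrix without expanding a
  determinant.\<close>

lemma monic_eq_prod_roots:
  fixes p :: "'a::idom poly"
  assumes "degree p = n" "lead_coeff p = 1" "inj_on l {..<n}" "\<And>i. i < n \<Longrightarrow> poly p (l i) = 0"
  shows "p = (\<Prod>i<n. [:- l i, 1:])"
proof (rule poly_eqI_degree_lead_coeff[where n = n and A = "l ` {..<n}"])
  have deg: "degree (\<Prod>i<n. [:- l i, 1:]) = n"
    by (subst degree_prod_eq_sum_degree) auto
  then show "degree (\<Prod>i<n. [:- l i, 1:]) \<le> n" by simp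
  have "lead_coeff (\<Prod>i<n. [:- l i, 1:]) = 1"
    by (simp add: lead_coeff_prod)
  then show "coeff p n = coeff (\<Prod>i<n. [:- l i, 1:]) n"
    using assms deg by simp
  show "card (l ` {..<n}) \<ge> n" "degree p \<le> n" using assms by (auto simp: card_image)
  fix z assume "z \<in> l ` {..<n}"
  then show "poly p z = poly (\<Prod>i<n. [:- l i, 1:]) z"
    using assms by (force simp: poly_prod)
qed

lemma sgn_prod_count:
  fixes l :: "nat \<Rightarrow> real"
  assumes "\<And>i. i < n \<Longrightarrow> x \<noteq> l i"
  shows "sgn (\<Prod>i<n. x - l i) = (-1) ^ (n + card {i. i < n \<and> l i \<le> x})"
  using assms
proof (induction n)
  case (Suc n)
  have "{i. i < Suc n \<and> l i \<le> x} = {i. i < n \<and> l i \<le> x} \<union> (if l n \<le> x then {n} else {})"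
    by (auto simp: less_Suc_eq)
  moreover have "card ({i. i < n \<and> l i \<le> x} \<union> {n}) = Suc (card {i. i < n \<and> l i \<le> x})"
    by (subst card_Un_disjoint) auto
  ultimately show ?case using Suc by (auto simp: sgn_mult less_le)
qed auto

text \<open>The characteristic polynomial of a leading block of a tridiagonal matrix, expanded along
  its last row: \<open>d\<close> is the diagonal and \<open>b n\<close> the product of the two
  off-diagonal entries linking \<open>n\<close> and \<open>n + 1\<close>.\<close>

fun tridiag_poly :: "(nat \<Rightarrow> real) \<Rightarrow> (nat \<Rightarrow> real) \<Rightarrow> nat \<Rightarrow> real poly" where
  "tridiag_poly d b 0 = 1"
| "tridiag_poly d b (Suc 0) = [:- d 0, 1:]"
| "tridiag_poly d b (Suc (Suc n)) =
     [:- d (Suc n), 1:] * tridiag_poly d b (Suc n) - Polynomial.smult (b n) (tridiag_poly d b n)"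

lemma tridiag_poly_monic:
  "degree (tridiag_poly d b n) = n \<and> lead_coeff (tridiag_poly d b n) = 1"
proof (induction d b n rule: tridiag_poly.induct)
  case (3 d b n)
  let ?p = "[:- d (Suc n), 1:] * tridiag_poly d b (Suc n)" and ?q = "Polynomial.smult (b n) (tridiag_poly d b n)"
  have ne: "tridiag_poly d b (Suc n) \<noteq> 0" using 3 by auto
  have dp: "degree ?p = Suc (Suc n)"
    using 3 ne by (subst degree_mult_eq) auto
  have "coeff (tridiag_poly d b (Suc n)) (Suc n) = 1" using 3 by metis
  then have lp: "lead_coeff ?p = 1"
    using 3 by (subst lead_coeff_mult) simp
  have dq: "degree ?q < Suc (Suc n)"
    using 3 by (intro le_less_trans[OF degree_smult_le]) auto
  have "degree (?p - ?q) = Suc (Suc n)"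
    using dp dq degree_add_eq_left[of "- ?q" ?p] by simp
  moreover have "coeff (?p - ?q) (Suc (Suc n)) = 1"
    using dp lp dq coeff_eq_0[OF dq] by simp
  ultimately show ?case unfolding tridiag_poly.simps(3) by metis
qed auto

declare tridiag_poly.simps(3) [simp del]

text \<open>Roots are numbered in decreasing order, so the sign found at \<open>m i\<close> depends
  on \<open>i\<close> alone and not on the degree.\<close>

definition interlaced :: "nat \<Rightarrow> (nat \<Rightarrow> real) \<Rightarrow> (nat \<Rightarrow> real) \<Rightarrow> bool" where
  "interlaced n l m \<longleftrightarrow> (\<forall>i<n. m (Suc i) < l i \<and> l i < m i)"

lemma interlaced_decreasing:
  assumes "interlaced n l m" "i < j" "j \<le> n"
  shows "m j < m i" "j < n \<Longrightarrow> l j < l i" "m j < l i" "j < n \<Longrightarrow> l j < m i"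
proof -
  have *: "m j < m i" if "i < j" "j \<le> n" for i j
    using that
  proof (induction j)
    case (Suc j)
    have "m (Suc j) < m j"
      using assms(1) Suc.prems unfolding interlaced_def by (meson Suc_le_eq less_trans)
    with Suc show ?case by (cases "i = j") auto
  qed simp
  show "m j < m i" using * assms by blast
  have si: "m (Suc i) < l i" "l i < m i" using assms unfolding interlaced_def by auto
  have "m j \<le> m (Suc i)" using *[of "Suc i" j] assms by (cases "j = Suc i") auto
  then show 1: "m j < l i" using si by linarith
  show "l j < l i" "l j < m i" if "j < n" using that assms(1) 1 si unfolding interlaced_def by force+
qed

text \<open>Exactly the \<open>i\<close> points \<open>l j\<close> with \<open>j < i\<close> lie
  above \<open>m i\<close>, each contributing one negative factor.\<close>

lemma interlaced_prod_sgn: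
  assumes "interlaced n l m" "i \<le> n"
  shows "sgn (\<Prod>j<n. m i - l j) = (-1) ^ i"
proof -
  have lt: "m i < l j" if "j < i" for j
    using interlaced_decreasing(3)[OF assms(1) that assms(2)] .
  have gt: "l j < m i" if "i \<le> j" "j < n" for j
    using interlaced_decreasing(4)[OF assms(1), of i j] that assms(1)
    unfolding interlaced_def by (cases "i = j") auto
  have 1: "m i \<noteq> l j" if "j < n" for j
    using lt[of j] gt[of j] that by (cases "j < i") auto
  have eq: "j < n \<and> l j \<le> m i \<longleftrightarrow> i \<le> j \<and> j < n" for j
    using lt[of j] gt[of j] by (cases "j < i") auto
  have "{j. j < n \<and> l j \<le> m i} = {i..<n}"
    by (intro Set.set_eqI) (simp only: eq mem_Collect_eq atLeastLessThan_iff)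
  then have "sgn (\<Prod>j<n. m i - l j) = (-1) ^ (n + (n - i))"
    using sgn_prod_count[of n "m i" l] 1 by simp
  also have "n + (n - i) = i + 2 * (n - i)" using assms by simp
  also have "(-1::real) ^ \<dots> = (-1) ^ i" by (simp add: power_add)
  finally show ?thesis .
qed

lemma lead_coeff_pcompose_neg:
  fixes p :: "real poly"
  shows "lead_coeff (pcompose p [:0, -1:]) = lead_coeff p * (-1) ^ degree p"
  by (subst lead_coeff_comp) auto

text \<open>Between consecutive roots of the \<open>(n + 1)\<close>-st polynomial the recursion forces a sign change of
  the next one, and monicity supplies the two outermost sign changes.\<close>

lemma tridiag_poly_roots:
  assumes b: "\<And>n. b n > 0"
  obtains l m where "interlaced n l m"
    "tridiag_poly d b n = (\<Prod>i<n. [:- l i, 1:])"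
    "tridiag_poly d b (Suc n) = (\<Prod>i<Suc n. [:- m i, 1:])"
proof -
  have "\<exists>l m. interlaced n l m \<and> tridiag_poly d b n = (\<Prod>i<n. [:- l i, 1:]) \<and>
    tridiag_poly d b (Suc n) = (\<Prod>i<Suc n. [:- m i, 1:])"
  proof (induction n)
    case 0
    show ?case by (rule exI[of _ "\<lambda>_. 0"], rule exI[of _ "\<lambda>_. d 0"]) (auto simp: interlaced_def)
  next
    case (Suc n)
    then obtain l m where il: "interlaced n l m" and
      pl: "tridiag_poly d b n = (\<Prod>i<n. [:- l i, 1:])" and
      pm: "tridiag_poly d b (Suc n) = (\<Prod>i<Suc n. [:- m i, 1:])" by blast
    let ?p = "tridiag_poly d b (Suc (Suc n))"
    have mono: "lead_coeff ?p = 1" "degree ?p = Suc (Suc n)"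
      using tridiag_poly_monic[of d b "Suc (Suc n)"] by blast+
    have sgn_m: "sgn (poly ?p (m i)) = (-1) ^ Suc i" if "i \<le> n" for i
    proof -
      have "poly (tridiag_poly d b (Suc n)) (m i) = 0"
        unfolding pm poly_prod using that by (intro prod_zero) (auto intro!: bexI[of _ i])
      then have "poly ?p (m i) = - b n * (\<Prod>j<n. m i - l j)"
        by (simp add: tridiag_poly.simps(3) pl poly_prod)
      then show ?thesis using interlaced_prod_sgn[OF il that] b[of n] by (simp add: sgn_mult sgn_minus)
    qed
    obtain t where t: "\<And>x. x \<ge> t \<Longrightarrow> poly ?p x \<ge> 1"
      using poly_pinfty_gt_lc[of ?p] mono by auto
    \<comment> \<open>Reflection moves the behaviour at minus infinity to plus infinity; since the
      degree is \<open>n + 2\<close>, the factor \<open>(-1) ^ n\<close> makes the reflected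
      polynomial monic again.\<close>
    let ?q = "Polynomial.smult ((-1) ^ n) (pcompose ?p [:0, -1:])"
    have "lead_coeff ?q = 1"
      unfolding lead_coeff_smult lead_coeff_pcompose_neg mono(1) unfolding mono(2) by (simp flip: power_add)
    then obtain s where s: "\<And>x. x \<ge> s \<Longrightarrow> poly ?q x \<ge> 1"
      using poly_pinfty_gt_lc[of ?q] by auto
    define T where "T = max t (m 0 + 1)"
    define S where "S = min (- s) (m n - 1)"
    \<comment> \<open>The \<open>n + 3\<close> points where the sign is known: one above all old
      roots, the \<open>n + 1\<close> old roots, one below them. Signs alternate along them, so each
      of the \<open>n + 2\<close> gaps holds a new root.\<close>
    define r where "r i = (if i = 0 then T else if i \<le> Suc n then m (i - 1) else S)" for i
    have "poly ?q (- S) \<ge> 1" by (rule s) (auto simp: S_def)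
    then have "(-1) ^ n * poly ?p S \<ge> 1" by (simp only: poly_smult poly_pcompose) simp
    then have sS: "sgn (poly ?p S) = (-1) ^ n"
      by (cases "even n") (auto simp: sgn_if)
    have sgn_r: "sgn (poly ?p (r i)) = (-1) ^ i" if i: "i \<le> Suc (Suc n)" for i
    proof -
      consider "i = 0" | "1 \<le> i" "i \<le> Suc n" | "i = Suc (Suc n)" using i by linarith
      then show ?thesis
      proof cases
        case 1
        then show ?thesis using t[of T] by (simp add: r_def T_def)
      next
        case 2
        then show ?thesis using sgn_m[of "i - 1"] by (simp add: r_def)
      next
        case 3
        then show ?thesis using sS by (simp add: r_def)
      qed
    qed
    have r_dec: "r (Suc i) < r i" if i: "i \<le> Suc n" for i
    proof -
      consider "i = 0" | "1 \<le> i" "i \<le> n" | "i = Suc n" using i by linarith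
      then show ?thesis
        using interlaced_decreasing(1)[OF il, of "i - 1" i]
        by cases (auto simp: r_def T_def S_def)
    qed
    have "\<exists>z. r (Suc i) < z \<and> z < r i \<and> poly ?p z = 0" if "i \<le> Suc n" for i
    proof -
      have "sgn (poly ?p (r (Suc i)) * poly ?p (r i)) = -1"
        using that sgn_r[of i] sgn_r[of "Suc i"] by (simp add: sgn_mult flip: power_add)
      then have "poly ?p (r (Suc i)) * poly ?p (r i) < 0" by (simp only: sgn_1_neg)
      then show ?thesis using poly_IVT[OF r_dec[OF that]] by blast
    qed
    then obtain v where v: "\<And>i. i \<le> Suc n \<Longrightarrow> r (Suc i) < v i \<and> v i < r i \<and> poly ?p (v i) = 0"
      by metis
    have im: "interlaced (Suc n) m v"
      unfolding interlaced_def
    proof (intro allI impI)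
      fix i assume "i < Suc n"
      then show "v (Suc i) < m i \<and> m i < v i"
        using v[of i] v[of "Suc i"] by (auto simp: r_def)
    qed
    have "inj_on v {..<Suc (Suc n)}"
      by (rule linorder_inj_onI) (use interlaced_decreasing(1)[OF im] in \<open>force simp: less_Suc_eq_le\<close>)+
    then have "?p = (\<Prod>i<Suc (Suc n). [:- v i, 1:])"
      using mono v by (intro monic_eq_prod_roots) auto
    with im pm show ?case by blast
  qed
  with that show ?thesis by blast
qed

text \<open>Shifting indices by \<open>Suc\<close> sends \<open>L\<close> into \<open>M\<close>
  because \<open>m (Suc i) < l i\<close>, and \<open>l i < m i\<close> leaves \<open>n\<close> as
  the only index that \<open>M\<close> can have beyond \<open>L\<close>. If \<open>x\<close> equals
  some \<open>m k\<close>, then \<open>k\<close> is missed by the shift, so the first inclusion is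
  strict.\<close>

lemma interlaced_count:
  fixes x :: real
  assumes "interlaced n l m"
  defines "L \<equiv> {i. i < n \<and> l i \<le> x}" and "M \<equiv> {i. i < Suc n \<and> m i \<le> x}"
  shows "card L \<le> card M" "card M \<le> Suc (card L)"
    "k < Suc n \<Longrightarrow> m k = x \<Longrightarrow> card M = Suc (card L)"
proof -
  have fin: "finite L" "finite M" by (auto simp: L_def M_def)
  have il: "m (Suc i) < l i" "l i < m i" if "i < n" for i
    using assms(1) that by (auto simp: interlaced_def)
  have sub: "Suc ` L \<subseteq> M"
  proof clarify
    fix i assume "i \<in> L"
    then show "Suc i \<in> M" using il(1)[of i] by (auto simp: L_def M_def)
  qed
  have cS: "card (Suc ` L) = card L" by (rule card_image) auto
  then show "card L \<le> card M" using card_mono[OF fin(2) sub] by simp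
  have "M \<subseteq> insert n L"
  proof
    fix i assume "i \<in> M"
    then show "i \<in> insert n L" using il(2)[of i] by (cases "i < n") (auto simp: L_def M_def)
  qed
  then have "card M \<le> card (insert n L)" using fin by (intro card_mono) auto
  also have "\<dots> \<le> Suc (card L)" using card_insert_le_m1[of "Suc (card L)" L n] by simp
  finally show up: "card M \<le> Suc (card L)" .
  assume k: "k < Suc n" "m k = x"
  have "k \<notin> Suc ` L"
  proof
    assume "k \<in> Suc ` L"
    then obtain i where "k = Suc i" "i \<in> L" by blast
    then show False using il(1)[of i] k by (auto simp: L_def)
  qed
  moreover have "k \<in> M" using k by (simp add: M_def)
  ultimately have "Suc ` L \<subset> M" using sub by blast
  from psubset_card_mono[OF fin(2) this] show "card M = Suc (card L)"
    using up cS by simp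
qed

definition root_count :: "real poly \<Rightarrow> real \<Rightarrow> nat" where
  "root_count p x = size {# e \<in># proots p. e \<le> x #}"

lemma root_count_prod:
  fixes l :: "nat \<Rightarrow> real"
  shows "root_count (\<Prod>i<n. [:- l i, 1:]) x = card {i. i < n \<and> l i \<le> x}"
proof (induction n)
  case (Suc n)
  have "{i. i < Suc n \<and> l i \<le> x} = {i. i < n \<and> l i \<le> x} \<union> (if l n \<le> x then {n} else {})"
    by (auto simp: less_Suc_eq)
  moreover have "card ({i. i < n \<and> l i \<le> x} \<union> {n}) = Suc (card {i. i < n \<and> l i \<le> x})"
    by (subst card_Un_disjoint) auto
  moreover have "proots (\<Prod>i<Suc n. [:- l i, 1:]) = proots (\<Prod>i<n. [:- l i, 1:]) + {#l n#}"
    by (subst prod.lessThan_Suc, subst proots_mult) auto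
  ultimately show ?case using Suc unfolding root_count_def by simp
qed (simp add: root_count_def)

text \<open>The algebraic half of Sturm oscillation; \<open>count_eq_floor\<close> matches these
  properties of the count with the motion of the angle.\<close>

lemma root_count_tridiag_poly:
  fixes d b :: "nat \<Rightarrow> real" and x :: real
  assumes b: "\<And>n. b n > 0"
  defines "c \<equiv> \<lambda>n. root_count (tridiag_poly d b n) x"
  shows "c 0 = 0" "c n \<le> c (Suc n)" "c (Suc n) \<le> Suc (c n)"
    "poly (tridiag_poly d b (Suc n)) x = 0 \<Longrightarrow> c (Suc n) = Suc (c n)"
    "poly (tridiag_poly d b n) x \<noteq> 0 \<Longrightarrow> sgn (poly (tridiag_poly d b n) x) = (-1) ^ (n + c n)"
proof -
  show "c 0 = 0" by (simp add: c_def root_count_def)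
  obtain l m where il: "interlaced n l m" and
    pl: "tridiag_poly d b n = (\<Prod>i<n. [:- l i, 1:])" and
    pm: "tridiag_poly d b (Suc n) = (\<Prod>i<Suc n. [:- m i, 1:])"
    by (rule tridiag_poly_roots[where d = d and b = b and n = n]) (rule b)
  have cn: "c n = card {i. i < n \<and> l i \<le> x}" and cs: "c (Suc n) = card {i. i < Suc n \<and> m i \<le> x}"
    unfolding c_def pl pm by (rule root_count_prod)+
  show "c n \<le> c (Suc n)" "c (Suc n) \<le> Suc (c n)"
    unfolding cn cs using interlaced_count[OF il] by auto
  show "c (Suc n) = Suc (c n)" if 0: "poly (tridiag_poly d b (Suc n)) x = 0"
  proof -
    have "\<exists>k\<in>{..<Suc n}. poly [:- m k, 1:] x = 0"
      using 0 unfolding pm poly_prod by (simp only: prod_zero_iff finite_lessThan)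
    then obtain k where "k < Suc n" "m k = x" by auto
    then show ?thesis unfolding cn cs by (rule interlaced_count(3)[OF il])
  qed
  show "sgn (poly (tridiag_poly d b n) x) = (-1) ^ (n + c n)" if "poly (tridiag_poly d b n) x \<noteq> 0"
    using that sgn_prod_count[of n x l] unfolding cn by (auto simp: pl poly_prod)
qed

section \<open>One step of the Pruefer angle\<close>

text \<open>\<open>rot_den\<close> and \<open>e * rot_num\<close> are the scalar and the cross
  product of the unit vector at angle \<open>t\<close> with its image under one step of the rescaled
  system, so their quotient is the tangent of the angle turned.\<close>

definition rot_num :: "real \<Rightarrow> real \<Rightarrow> real \<Rightarrow> real" where
  "rot_num e w t = w * (cos t)\<^sup>2 + (sin t)\<^sup>2 + e * w * (sin t * cos t)"

definition rot_den :: "real \<Rightarrow> real \<Rightarrow> real \<Rightarrow> real" where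
  "rot_den e w t = 1 + e * ((w - 1) * (sin t * cos t) - e * w * (cos t)\<^sup>2)"

definition rot_step :: "real \<Rightarrow> real \<Rightarrow> real \<Rightarrow> real" where
  "rot_step e w t = arctan (e * rot_num e w t / rot_den e w t)"

text \<open>Positivity of \<open>rot_den\<close> puts the turned angle into the range of
  \<open>arctan\<close>, so no multiple of \<open>pi\<close> has to be corrected; \<open>s\<close>
  is the length of the image.\<close>

lemma rotation_identity:
  assumes "rot_den e w t > 0"
  obtains s where "s > 0"
    "cos t - e * (sin t + e * w * cos t) = s * cos (t + rot_step e w t)"
    "sin t + e * w * cos t = s * sin (t + rot_step e w t)"
proof
  let ?D = "rot_den e w t" and ?A = "e * rot_num e w t"
  let ?s = "sqrt (1 + (?A / ?D)\<^sup>2)"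
  have s0: "?s > 0" by (simp add: add_pos_nonneg)
  show "?D * ?s > 0" using s0 assms by simp
  have c: "?D * ?s * cos (rot_step e w t) = ?D"
    using s0 unfolding rot_step_def cos_arctan by simp
  have s: "?D * ?s * sin (rot_step e w t) = ?A"
    using s0 assms unfolding rot_step_def sin_arctan by simp
  have sc: "(sin t)\<^sup>2 + (cos t)\<^sup>2 = 1" by simp
  have "?D * ?s * cos (t + rot_step e w t) = cos t * ?D - sin t * ?A"
  proof -
    have "?D * ?s * cos (t + rot_step e w t) =
        cos t * (?D * ?s * cos (rot_step e w t)) - sin t * (?D * ?s * sin (rot_step e w t))"
      unfolding cos_add by (simp only: right_diff_distrib left_diff_distrib mult_ac)
    then show ?thesis by (simp only: c s)
  qed
  \<comment> \<open>The defect is displayed as an explicit multiple of the Pythagorean relation;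
    with the corresponding simplification rules removed this is a polynomial identity.\<close>
  moreover have "cos t * ?D - sin t * ?A - (cos t - e * (sin t + e * w * cos t)) =
      - (e * sin t + e * e * w * cos t) * ((sin t)\<^sup>2 + (cos t)\<^sup>2 - 1)"
    unfolding rot_num_def rot_den_def by (simp add: power2_eq_square algebra_simps del: sin_cos_squared_add sin_cos_squared_add2 sin_cos_squared_add3)
  ultimately show "cos t - e * (sin t + e * w * cos t) = ?D * ?s * cos (t + rot_step e w t)" using sc by simp
  have "?D * ?s * sin (t + rot_step e w t) = sin t * ?D + cos t * ?A"
  proof -
    have "?D * ?s * sin (t + rot_step e w t) =
        sin t * (?D * ?s * cos (rot_step e w t)) + cos t * (?D * ?s * sin (rot_step e w t))"
      unfolding sin_add by (simp only: distrib_left distrib_right mult_ac)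
    then show ?thesis by (simp only: c s)
  qed
  moreover have "sin t * ?D + cos t * ?A - (sin t + e * w * cos t) = e * w * cos t * ((sin t)\<^sup>2 + (cos t)\<^sup>2 - 1)"
    unfolding rot_num_def rot_den_def by (simp add: power2_eq_square algebra_simps del: sin_cos_squared_add sin_cos_squared_add2 sin_cos_squared_add3)
  ultimately show "sin t + e * w * cos t = ?D * ?s * sin (t + rot_step e w t)" using sc by simp
qed

section \<open>Elementary Lipschitz and Taylor estimates\<close>

lemma abs_sin_cos_le: "\<bar>sin t * cos t\<bar> \<le> (1::real)"
  by (simp add: abs_mult mult_le_one)

lemma lipschitz_of_deriv_bound:
  fixes f :: "real \<Rightarrow> real"
  assumes "\<And>z. (f has_real_derivative f' z) (at z)" "\<And>z. \<bar>f' z\<bar> \<le> B"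
  shows "\<bar>f s - f t\<bar> \<le> B * \<bar>s - t\<bar>"
  using field_differentiable_bound[of UNIV f f' B s t] assms by simp

lemma cos_squared_lipschitz: "\<bar>(cos s)\<^sup>2 - (cos t)\<^sup>2\<bar> \<le> 2 * \<bar>s - t :: real\<bar>"
proof (rule lipschitz_of_deriv_bound)
  show "((\<lambda>z. (cos z)\<^sup>2) has_real_derivative - 2 * (sin z * cos z)) (at z)" for z :: real
    by (auto intro!: derivative_eq_intros)
  show "\<bar>- 2 * (sin z * cos z)\<bar> \<le> 2" for z :: real
    using abs_sin_cos_le[of z] by (simp add: abs_mult)
qed

lemma sin_cos_lipschitz: "\<bar>sin s * cos s - sin t * cos t\<bar> \<le> 2 * \<bar>s - t :: real\<bar>"
proof (rule lipschitz_of_deriv_bound)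
  show "((\<lambda>z. sin z * cos z) has_real_derivative (cos z)\<^sup>2 - (sin z)\<^sup>2) (at z)" for z :: real
    by (auto intro!: derivative_eq_intros simp: power2_eq_square)
  show "\<bar>(cos z)\<^sup>2 - (sin z)\<^sup>2\<bar> \<le> 2" for z :: real
    using sin_cos_squared_add[of z] zero_le_power2[of "sin z"] zero_le_power2[of "cos z"] by linarith
qed

lemma arctan_lipschitz: "\<bar>arctan s - arctan t\<bar> \<le> \<bar>s - t\<bar>"
proof -
  have "\<bar>arctan s - arctan t\<bar> \<le> 1 * \<bar>s - t\<bar>"
  proof (rule lipschitz_of_deriv_bound)
    show "(arctan has_real_derivative inverse (1 + z\<^sup>2)) (at z)" for z
      by (rule DERIV_arctan)
    show "\<bar>inverse (1 + z\<^sup>2)\<bar> \<le> 1" for z :: real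
      by (simp add: inverse_le_1_iff)
  qed
  then show ?thesis by simp
qed

text \<open>The derivative of the difference is \<open>- z\<^sup>2 / (1 + z\<^sup>2)\<close>, whose
  modulus is at most that of \<open>z\<close>. A quadratic error suffices because the arguments that
  occur are of order \<open>e\<close>.\<close>

lemma arctan_approx: "\<bar>arctan y - y\<bar> \<le> y\<^sup>2"
proof -
  have "norm ((arctan y - y) - (arctan 0 - 0)) \<le> \<bar>y\<bar> * norm (y - 0)"
  proof (rule field_differentiable_bound[where S = "{- \<bar>y\<bar>..\<bar>y\<bar>}" and f' = "\<lambda>z. inverse (1 + z\<^sup>2) - 1"])
    show "((\<lambda>z. arctan z - z) has_field_derivative inverse (1 + z\<^sup>2) - 1)
        (at z within {- \<bar>y\<bar>..\<bar>y\<bar>})" for z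
      by (auto intro!: derivative_eq_intros)
    show "norm (inverse (1 + z\<^sup>2) - 1) \<le> \<bar>y\<bar>" if "z \<in> {- \<bar>y\<bar>..\<bar>y\<bar>}" for z
    proof -
      have pos: "1 + z\<^sup>2 > 0" by (simp add: add_pos_nonneg)
      have "inverse (1 + z\<^sup>2) - 1 = - (z\<^sup>2 / (1 + z\<^sup>2))"
        using pos by (simp add: field_simps)
      then have "norm (inverse (1 + z\<^sup>2) - 1) = z\<^sup>2 / (1 + z\<^sup>2)"
        using pos by simp
      also have "\<dots> \<le> \<bar>z\<bar>"
      proof -
        have "\<bar>z\<bar> * (1 + z\<^sup>2 - \<bar>z\<bar>) \<ge> 0"
        proof -
          have "0 \<le> (\<bar>z\<bar> - 1/2)\<^sup>2" by simp
          then have "1 + z\<^sup>2 - \<bar>z\<bar> \<ge> 0" by (simp add: power2_eq_square algebra_simps del: sin_cos_squared_add sin_cos_squared_add2 sin_cos_squared_add3)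
          then show ?thesis by simp
        qed
        moreover have "\<bar>z\<bar> * \<bar>z\<bar> = z\<^sup>2" by (simp add: power2_eq_square)
        ultimately have "z\<^sup>2 \<le> \<bar>z\<bar> * (1 + z\<^sup>2)" by (simp only: right_diff_distrib)
        then show ?thesis using pos by (simp add: pos_divide_le_eq)
      qed
      also have "\<dots> \<le> \<bar>y\<bar>" using that by auto
      finally show ?thesis .
    qed
  qed auto
  then show ?thesis by (simp add: power2_eq_square)
qed

text \<open>\<open>M\<close> will bound the weights \<open>\<kappa> / a\<close>. The condition
  \<open>4 * M * e \<le> 1\<close> keeps \<open>rot_den\<close> within 1/2 of 1, and
  \<open>1 \<le> M\<close> lets lower powers of \<open>M\<close> be absorbed into higher
  ones.\<close>

locale small_step =
  fixes M e :: real
  assumes M: "1 \<le> M" and e: "0 < e" "4 * M * e \<le> 1"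
begin

lemma e_le: "e \<le> 1 / 4"
proof -
  have "1 * e \<le> M * e" using M e by (intro mult_right_mono) auto
  then show ?thesis using e by linarith
qed

lemma rot_den_close:
  assumes "0 \<le> w" "w \<le> M"
  shows "\<bar>rot_den e w t - 1\<bar> \<le> 2 * M * e"
proof -
  have 1: "\<bar>(w - 1) * (sin t * cos t)\<bar> \<le> M * 1"
    unfolding abs_mult[of "w - 1"] by (intro mult_mono abs_sin_cos_le) (use assms M in auto)
  have 2: "0 \<le> e * w * (cos t)\<^sup>2" "e * w * (cos t)\<^sup>2 \<le> M"
  proof -
    have "e * w * (cos t)\<^sup>2 \<le> 1 * M * 1"
      by (intro mult_mono) (use assms e_le e M in \<open>auto simp: abs_square_le_1\<close>)
    then show "0 \<le> e * w * (cos t)\<^sup>2" "e * w * (cos t)\<^sup>2 \<le> M" using assms e by auto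
  qed
  have "\<bar>(w - 1) * (sin t * cos t) - e * w * (cos t)\<^sup>2\<bar> \<le> 2 * M" using 1 2 by linarith
  then have "e * \<bar>(w - 1) * (sin t * cos t) - e * w * (cos t)\<^sup>2\<bar> \<le> e * (2 * M)"
    by (rule mult_left_mono) (use e in auto)
  then show ?thesis using e by (simp add: rot_den_def abs_mult mult_ac)
qed

lemma rot_den_bounds:
  assumes "0 \<le> w" "w \<le> M"
  shows "1 / 2 \<le> rot_den e w t" "rot_den e w t \<le> 3 / 2"
  using rot_den_close[OF assms, of t] e by linarith+

lemma weight_bounds:
  assumes "0 \<le> w" "w \<le> M"
  shows "0 \<le> w * (cos t)\<^sup>2 + (sin t)\<^sup>2" "w * (cos t)\<^sup>2 + (sin t)\<^sup>2 \<le> M"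
proof -
  have "w * (cos t)\<^sup>2 + (sin t)\<^sup>2 \<le> M * (cos t)\<^sup>2 + M * (sin t)\<^sup>2"
    using assms M by (intro add_mono mult_right_mono) (auto intro: mult_right_mono[of 1 M, simplified])
  also have "\<dots> = M" using sin_cos_squared_add[of t] by (simp flip: distrib_left)
  finally show "w * (cos t)\<^sup>2 + (sin t)\<^sup>2 \<le> M" .
qed (use assms in auto)

lemma abs_w_sin_cos_le:
  assumes "0 \<le> w" "w \<le> M"
  shows "\<bar>e * w * (sin t * cos t)\<bar> \<le> M * e"
proof -
  have "\<bar>e * w\<bar> * \<bar>sin t * cos t\<bar> \<le> (M * e) * 1"
    by (intro mult_mono abs_sin_cos_le) (use assms e M in auto)
  then show ?thesis by (simp add: abs_mult)
qed

lemma rot_num_abs_le: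
  assumes "0 \<le> w" "w \<le> M"
  shows "\<bar>rot_num e w t\<bar> \<le> 2 * M"
proof -
  have "M * e \<le> M" using e_le M e by (simp add: mult_left_le)
  then show ?thesis
    unfolding rot_num_def using weight_bounds[OF assms, of t] abs_w_sin_cos_le[OF assms, of t] by linarith
qed

lemma rot_num_pos:
  assumes "0 < w" "w \<le> M"
  shows "rot_num e w t > 0"
proof -
  have "e * e * w \<le> 1 * (e * M)"
    using assms e e_le M unfolding mult.assoc by (intro mult_mono) auto
  moreover have "e * M \<le> 1 / 4" using e by (simp add: mult_ac)
  ultimately have "e * e * w < 4" by linarith
  then have *: "w * (1 - e * e * w / 4) > 0" using assms by simp
  \<comment> \<open>Completing the square: the quadratic form is positive definite because
    \<open>e * e * w < 4\<close>. Hence the angle strictly increases.\<close>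
  have eq: "rot_num e w t = (sin t + e * w * cos t / 2)\<^sup>2 + w * (1 - e * e * w / 4) * (cos t)\<^sup>2"
    by (simp add: rot_num_def power2_eq_square algebra_simps)
  show ?thesis
  proof (cases "cos t = 0")
    case True
    then have "(sin t)\<^sup>2 = 1" using sin_cos_squared_add[of t] by simp
    then show ?thesis by (simp add: rot_num_def True)
  next
    case False
    then have "w * (1 - e * e * w / 4) * (cos t)\<^sup>2 > 0" using * by simp
    then show ?thesis unfolding eq by (simp add: add_nonneg_pos)
  qed
qed

lemma rot_step_bounds:
  assumes "0 < w" "w \<le> M"
  shows "0 < rot_step e w t" "rot_step e w t < pi / 2"
proof -
  have "rot_den e w t > 0" using rot_den_bounds(1)[of w t] assms by linarith
  then show "0 < rot_step e w t"
    using rot_num_pos[OF assms, of t] e by (simp add: rot_step_def)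
  show "rot_step e w t < pi / 2" unfolding rot_step_def by (rule arctan_ubound)
qed

text \<open>Two replacements cost an error of order \<open>e\<^sup>2\<close>. Taking the argument of
  \<open>arctan\<close> for its value contributes 16, as that argument is at most
  \<open>4 * M * e\<close>; dropping the corrections of order \<open>e\<close> in numerator and
  denominator contributes 6.\<close>

lemma rot_step_expansion:
  assumes "0 \<le> w" "w \<le> M"
  shows "\<bar>rot_step e w t - e * (1 + (w - 1) * (cos t)\<^sup>2)\<bar> \<le> 22 * M\<^sup>2 * e\<^sup>2"
proof -
  let ?A = "rot_num e w t" and ?D = "rot_den e w t" and ?G = "w * (cos t)\<^sup>2 + (sin t)\<^sup>2"
  have D: "?D \<ge> 1 / 2" "\<bar>?D - 1\<bar> \<le> 2 * M * e" using rot_den_bounds rot_den_close assms by auto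
  have G: "1 + (w - 1) * (cos t)\<^sup>2 = ?G"
    using sin_cos_squared_add[of t] by (simp add: algebra_simps)
  have "\<bar>e * ?A / ?D\<bar> \<le> e * (2 * M) / (1 / 2)"
    unfolding abs_mult abs_divide
    by (intro frac_le mult_mono) (use D e M rot_num_abs_le[OF assms, of t] in auto)
  then have y: "\<bar>e * ?A / ?D\<bar> \<le> 4 * M * e" by (simp add: mult_ac)
  then have "(e * ?A / ?D)\<^sup>2 \<le> (4 * M * e)\<^sup>2"
    by (metis abs_ge_zero power2_abs power_mono)
  then have 1: "\<bar>rot_step e w t - e * ?A / ?D\<bar> \<le> 16 * M\<^sup>2 * e\<^sup>2"
    unfolding rot_step_def using arctan_approx[of "e * ?A / ?D"] by (simp add: power_mult_distrib)
  have "?A - ?G * ?D = e * w * (sin t * cos t) - ?G * (?D - 1)"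
    by (simp add: rot_num_def algebra_simps)
  moreover have "\<bar>?G * (?D - 1)\<bar> \<le> M * (2 * M * e)"
    unfolding abs_mult using weight_bounds[OF assms, of t] D M e by (intro mult_mono) auto
  moreover have "M * e \<le> M * M * e" using M e by (intro mult_right_mono) auto
  ultimately have "\<bar>?A - ?G * ?D\<bar> \<le> 3 * M\<^sup>2 * e"
    using abs_w_sin_cos_le[OF assms, of t] by (simp add: power2_eq_square algebra_simps del: sin_cos_squared_add sin_cos_squared_add2 sin_cos_squared_add3)
  then have "\<bar>?A - ?G * ?D\<bar> / ?D \<le> (3 * M\<^sup>2 * e) / (1 / 2)"
    using D M e by (intro frac_le) auto
  then have "e * (\<bar>?A - ?G * ?D\<bar> / ?D) \<le> e * (6 * M\<^sup>2 * e)"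
    using e by (intro mult_left_mono) auto
  moreover have "\<bar>e * ?A / ?D - e * ?G\<bar> = e * (\<bar>?A - ?G * ?D\<bar> / ?D)"
  proof -
    have "e * ?A / ?D - e * ?G = e * ((?A - ?G * ?D) / ?D)" using D by (simp add: field_simps)
    then show ?thesis using D e by (simp add: abs_mult)
  qed
  ultimately have 2: "\<bar>e * ?A / ?D - e * ?G\<bar> \<le> 6 * M\<^sup>2 * e\<^sup>2" by (simp add: power2_eq_square mult_ac)
  have "\<bar>x - z\<bar> \<le> p + q" if "\<bar>x - y\<bar> \<le> p" "\<bar>y - z\<bar> \<le> q" for x y z p q :: real
    using that by linarith
  from this[OF 1 2] show ?thesis unfolding G by (simp add: mult_ac)
qed

text \<open>The factor \<open>e\<close> is the point: in \<open>ph_lipschitz\<close> it keeps the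
  sensitivity of the angle to its past below the expansion of the doubling map.\<close>

lemma rot_step_lipschitz:
  assumes w: "0 \<le> w" "w \<le> M" and v: "0 \<le> v" "v \<le> M"
  shows "\<bar>rot_step e w t - rot_step e v s\<bar> \<le> 80 * M\<^sup>2 * e * (\<bar>w - v\<bar> + \<bar>t - s\<bar>)"
proof -
  let ?A = "rot_num e w t" and ?D = "rot_den e w t" and ?A' = "rot_num e v s" and ?D' = "rot_den e v s"
  define h where "h = \<bar>w - v\<bar> + \<bar>t - s\<bar>"
  have h: "0 \<le> h" by (simp add: h_def)
  \<comment> \<open>Covers \<open>(cos t)\<^sup>2\<close> and \<open>sin t * cos t\<close> at once,
    both bounded by 1 and Lipschitz with constant 2.\<close>
  have prod: "\<bar>w * f t - v * f s\<bar> \<le> 2 * M * h"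
    if "\<bar>f t\<bar> \<le> 1" "\<bar>f t - f s\<bar> \<le> 2 * \<bar>t - s\<bar>" for f :: "real \<Rightarrow> real"
  proof -
    have "w * f t - v * f s = (w - v) * f t + v * (f t - f s)" by (simp add: algebra_simps)
    moreover have "\<bar>(w - v) * f t\<bar> \<le> \<bar>w - v\<bar> * 1"
      unfolding abs_mult using that by (intro mult_left_mono) auto
    moreover have "\<bar>v * (f t - f s)\<bar> \<le> M * (2 * \<bar>t - s\<bar>)"
      unfolding abs_mult using that v M by (intro mult_mono) auto
    moreover have "\<bar>w - v\<bar> * 1 \<le> \<bar>w - v\<bar> * (2 * M)" using M by (intro mult_left_mono) auto
    ultimately show ?thesis unfolding h_def by (simp add: algebra_simps)
  qed
  have c2: "\<bar>w * (cos t)\<^sup>2 - v * (cos s)\<^sup>2\<bar> \<le> 2 * M * h"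
    by (rule prod[of "\<lambda>t. (cos t)\<^sup>2"]) (auto simp: abs_square_le_1 cos_squared_lipschitz)
  have sc: "\<bar>w * (sin t * cos t) - v * (sin s * cos s)\<bar> \<le> 2 * M * h"
    by (rule prod[of "\<lambda>t. sin t * cos t"]) (auto simp: abs_sin_cos_le sin_cos_lipschitz)
  have hM: "h \<le> M * h" using M h mult_right_mono[of 1 M h] by simp
  have e': "e * \<bar>z\<bar> \<le> \<bar>z\<bar> / 4" for z
    using mult_right_mono[OF e_le, of "\<bar>z\<bar>"] by simp
  have A: "\<bar>?A - ?A'\<bar> \<le> 5 * M * h"
  proof -
    have "?A - ?A' = (w * (cos t)\<^sup>2 - v * (cos s)\<^sup>2) - ((cos t)\<^sup>2 - (cos s)\<^sup>2)
        + e * (w * (sin t * cos t) - v * (sin s * cos s))"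
      using sin_cos_squared_add[of t] sin_cos_squared_add[of s] by (simp add: rot_num_def algebra_simps)
    moreover have "\<bar>e * (w * (sin t * cos t) - v * (sin s * cos s))\<bar> \<le> 2 * M * h / 4"
      using e'[of "w * (sin t * cos t) - v * (sin s * cos s)"] sc e by (simp add: abs_mult)
    moreover have "\<bar>(cos t)\<^sup>2 - (cos s)\<^sup>2\<bar> \<le> 2 * h"
      by (rule order_trans[OF cos_squared_lipschitz]) (simp add: h_def)
    ultimately show ?thesis using c2 hM h by linarith
  qed
  have D: "\<bar>?D - ?D'\<bar> \<le> 2 * M * h"
  proof -
    define z where "z = (w * (sin t * cos t) - v * (sin s * cos s)) - (sin t * cos t - sin s * cos s)
        - e * (w * (cos t)\<^sup>2 - v * (cos s)\<^sup>2)"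
    have "?D - ?D' = e * z" by (simp add: rot_den_def z_def algebra_simps)
    moreover have "\<bar>z\<bar> \<le> 8 * M * h"
    proof -
      have "\<bar>e * (w * (cos t)\<^sup>2 - v * (cos s)\<^sup>2)\<bar> \<le> 2 * M * h / 4"
        using e'[of "w * (cos t)\<^sup>2 - v * (cos s)\<^sup>2"] c2 e by (simp add: abs_mult)
      moreover have "\<bar>sin t * cos t - sin s * cos s\<bar> \<le> 2 * h"
        by (rule order_trans[OF sin_cos_lipschitz]) (simp add: h_def)
      ultimately show ?thesis unfolding z_def using sc hM h by linarith
    qed
    ultimately show ?thesis using e'[of z] e by (simp add: abs_mult)
  qed
  have B: "1 / 2 \<le> ?D" "?D \<le> 3 / 2" "1 / 2 \<le> ?D'" "?D' \<le> 3 / 2" "\<bar>?A'\<bar> \<le> 2 * M"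
    using rot_den_bounds w v rot_num_abs_le by auto
  \<comment> \<open>Quotient rule for differences. As both denominators are at least 1/2, the bound
    20 for the numerator becomes 80.\<close>
  have "?A / ?D - ?A' / ?D' = ((?A - ?A') * ?D' - ?A' * (?D - ?D')) / (?D * ?D')"
    using B by (simp add: field_simps)
  then have "\<bar>?A / ?D - ?A' / ?D'\<bar> = \<bar>(?A - ?A') * ?D' - ?A' * (?D - ?D')\<bar> / (?D * ?D')"
    using B by (simp add: abs_mult)
  also have "\<dots> \<le> (20 * M\<^sup>2 * h) / (1 / 2 * (1 / 2))"
  proof (rule frac_le)
    have "\<bar>(?A - ?A') * ?D'\<bar> \<le> (5 * M * h) * (3 / 2)"
      unfolding abs_mult using A B M h by (intro mult_mono) auto
    moreover have "\<bar>?A' * (?D - ?D')\<bar> \<le> (2 * M) * (2 * M * h)"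
      unfolding abs_mult using D B M h by (intro mult_mono) auto
    moreover have "M * h \<le> M\<^sup>2 * h"
      using M h by (intro mult_right_mono) (auto simp: power2_eq_square)
    moreover have "0 \<le> M * h" using M h by simp
    ultimately show "\<bar>(?A - ?A') * ?D' - ?A' * (?D - ?D')\<bar> \<le> 20 * M\<^sup>2 * h"
      by (simp add: power2_eq_square mult_ac)
    show "1 / 2 * (1 / 2) \<le> ?D * ?D'" using B by (intro mult_mono) auto
  qed (use M h in auto)
  finally have "\<bar>?A / ?D - ?A' / ?D'\<bar> \<le> 80 * M\<^sup>2 * h" by simp
  then have "e * \<bar>?A / ?D - ?A' / ?D'\<bar> \<le> e * (80 * M\<^sup>2 * h)"
    by (rule mult_left_mono) (use e in auto)
  moreover have "\<bar>e * ?A / ?D - e * ?A' / ?D'\<bar> = e * \<bar>?A / ?D - ?A' / ?D'\<bar>"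
    using e by (simp add: abs_mult flip: times_divide_eq_right right_diff_distrib)
  ultimately show ?thesis
    unfolding rot_step_def h_def[symmetric]
    using arctan_lipschitz[of "e * ?A / ?D" "e * ?A' / ?D'"] by (simp add: mult_ac)
qed

end

text \<open>The angle is lifted to the real line rather than taken modulo \<open>pi\<close>, so that
  it counts half-turns. The start 0 encodes the Dirichlet condition at -1.\<close>

primrec phase :: "real \<Rightarrow> (nat \<Rightarrow> real) \<Rightarrow> nat \<Rightarrow> real" where
  "phase e w 0 = 0"
| "phase e w (Suc n) = phase e w n + rot_step e (w n) (phase e w n)"

section \<open>Eigenvalue counting by the Pruefer angle\<close>

text \<open>The eigenvalue equation as a first-order system for \<open>a_n (u_n - u_{n-1})\<close>
  and \<open>u_{n-1}\<close>. The second index is shifted: \<open>sol c E n\<close> is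
  \<open>u_{n-1}\<close>, with \<open>u_{-1} = 0\<close> and \<open>u_0 = 1\<close>.\<close>

primrec flux_sol :: "(nat \<Rightarrow> real) \<Rightarrow> real \<Rightarrow> nat \<Rightarrow> real \<times> real" where
  "flux_sol c E 0 = (c 0, 0)"
| "flux_sol c E (Suc n) =
     (let u = snd (flux_sol c E n) + fst (flux_sol c E n) / c n
      in (fst (flux_sol c E n) - E * u, u))"

definition flux :: "(nat \<Rightarrow> real) \<Rightarrow> real \<Rightarrow> nat \<Rightarrow> real" where
  "flux c E n = fst (flux_sol c E n)"

definition sol :: "(nat \<Rightarrow> real) \<Rightarrow> real \<Rightarrow> nat \<Rightarrow> real" where
  "sol c E n = snd (flux_sol c E n)"

lemma flux_sol_simps:
  "flux c E 0 = c 0" "sol c E 0 = 0"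
  "sol c E (Suc n) = sol c E n + flux c E n / c n"
  "flux c E (Suc n) = flux c E n - E * sol c E (Suc n)"
  by (simp_all add: flux_def sol_def Let_def)

lemma sol_recurrence:
  assumes "\<And>n. c n > 0"
  shows "c (Suc n) * sol c E (Suc (Suc n)) =
    (c n + c (Suc n) - E) * sol c E (Suc n) - c n * sol c E n"
proof -
  have 1: "c k * sol c E (Suc k) = c k * sol c E k + flux c E k" for k
    using assms[of k] by (simp add: flux_sol_simps field_simps)
  show ?thesis
    using 1[of n] 1[of "Suc n"] unfolding flux_sol_simps(4) by (simp add: algebra_simps)
qed

abbreviation jacobi_poly :: "(nat \<Rightarrow> real) \<Rightarrow> nat \<Rightarrow> real poly" where
  "jacobi_poly c \<equiv> tridiag_poly (\<lambda>n. c n + c (Suc n)) (\<lambda>n. (c (Suc n))\<^sup>2)"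

text \<open>Scaling by the off-diagonal coefficients and alternating the sign turns the three-term
  recurrence of the solution into that of \<open>jacobi_poly\<close>; the first two values agree as
  well.\<close>

lemma sol_eq_jacobi_poly:
  assumes c: "\<And>n. c n > 0"
  shows "sol c E (Suc n) * (\<Prod>i<n. c (Suc i)) = (-1) ^ n * poly (jacobi_poly c n) E"
proof (induction n rule: less_induct)
  case (less n)
  consider "n = 0" | "n = 1" | k where "n = Suc (Suc k)"
    by (metis One_nat_def not0_implies_Suc)
  then show ?case
  proof cases
    case 1
    then show ?thesis using c[of 0] by (simp add: flux_sol_simps)
  next
    case 2
    then show ?thesis using c[of 0] c[of 1] by (simp add: flux_sol_simps field_simps)
  next
    case 3
    let ?P = "\<Prod>i<k. c (Suc i)"
    have IH: "sol c E (Suc k) * ?P = (-1) ^ k * poly (jacobi_poly c k) E"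
      "sol c E (Suc (Suc k)) * (?P * c (Suc k)) = - ((-1) ^ k * poly (jacobi_poly c (Suc k)) E)"
      using less.IH[of k] less.IH[of "Suc k"] 3 by simp_all
    have "sol c E (Suc (Suc (Suc k))) * (?P * c (Suc k) * c (Suc (Suc k))) =
        (c (Suc k) + c (Suc (Suc k)) - E) * (sol c E (Suc (Suc k)) * (?P * c (Suc k)))
        - (c (Suc k))\<^sup>2 * (sol c E (Suc k) * ?P)"
    proof -
      have "sol c E (Suc (Suc (Suc k))) * (?P * c (Suc k) * c (Suc (Suc k))) =
          ?P * c (Suc k) * (c (Suc (Suc k)) * sol c E (Suc (Suc (Suc k))))" by simp
      then show ?thesis
        unfolding sol_recurrence[of c "Suc k" E, OF c] by (simp add: power2_eq_square algebra_simps)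
    qed
    also have "\<dots> = (-1) ^ k * poly (jacobi_poly c (Suc (Suc k))) E"
      unfolding IH tridiag_poly.simps(3) by (simp add: algebra_simps)
    finally show ?thesis using 3 by simp
  qed
qed

section \<open>The Dirichlet matrix and its characteristic polynomial\<close>

lemma jacobi_mat_mult:
  assumes "i < N"
  shows "(jacobi_mat a x N *\<^sub>v Matrix.vec N v) $ i = jacobi a x (\<lambda>k. if k < N then v k else 0) i"
proof -
  have "(jacobi_mat a x N *\<^sub>v Matrix.vec N v) $ i =
      (\<Sum>j = 0..<N. jacobi a x (\<lambda>k. if k = j then 1 else 0) i * v j)"
    using assms by (simp add: jacobi_mat_def scalar_prod_def)
  also have "\<dots> = (\<Sum>j = 0..<N. - coef a x (i + 1) * (if i + 1 = j then v j else 0)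
      + (coef a x i + coef a x (i + 1)) * (if i = j then v j else 0)
      - coef a x i * (if i = 0 then 0 else if i - 1 = j then v j else 0))"
    by (intro sum.cong refl) (auto simp: jacobi_def algebra_simps)
  also have "\<dots> = jacobi a x (\<lambda>k. if k < N then v k else 0) i"
    by (simp add: jacobi_def sum.distrib sum_subtractf flip: sum_distrib_left)
  finally show ?thesis .
qed

text \<open>If \<open>u_N = 0\<close>, cutting the solution off at \<open>N\<close> changes nothing
  in the last row, so the truncation is an eigenvector; it is nonzero because
  \<open>u_0 = 1\<close>.\<close>

lemma sol_zero_imp_root_char_poly:
  assumes c: "\<And>n. coef a x n > 0" and N: "N > 0"
    and zero: "sol (coef a x) E (Suc N) = 0"
  shows "poly (char_poly (jacobi_mat a x N)) E = 0"
proof -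
  let ?A = "jacobi_mat a x N" and ?u = "\<lambda>k. sol (coef a x) E (Suc k)"
  have A: "?A \<in> carrier_mat N N" by (simp add: jacobi_mat_def)
  have "?A *\<^sub>v Matrix.vec N ?u = E \<cdot>\<^sub>v Matrix.vec N ?u"
  proof (rule eq_vecI)
    fix i assume "i < dim_vec (E \<cdot>\<^sub>v Matrix.vec N ?u)"
    then have i: "i < N" by simp
    have nz: "(if i + 1 < N then ?u (i + 1) else 0) = ?u (i + 1)"
      using i zero by (cases "Suc i = N") auto
    have "jacobi a x (\<lambda>k. if k < N then ?u k else 0) i = E * ?u i"
      unfolding jacobi_def nz using i sol_recurrence[of "coef a x" i E, OF c]
      by (cases i) (auto simp: algebra_simps flux_sol_simps(2))
    then show "(?A *\<^sub>v Matrix.vec N ?u) $ i = (E \<cdot>\<^sub>v Matrix.vec N ?u) $ i"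
      using i jacobi_mat_mult[OF i, of a x ?u] by simp
  qed (use A in auto)
  moreover have "Matrix.vec N ?u \<noteq> 0\<^sub>v N"
  proof
    assume "Matrix.vec N ?u = 0\<^sub>v N"
    then have "Matrix.vec N ?u $ 0 = 0" using N by simp
    then show False using N c[of 0] by (simp add: flux_sol_simps)
  qed
  ultimately have "eigenvector ?A (Matrix.vec N ?u) E"
    using A by (simp add: eigenvector_def)
  then have "eigenvalue ?A E" unfolding eigenvalue_def by blast
  then show ?thesis using eigenvalue_root_char_poly[OF A] by simp
qed

text \<open>By interlacing the recursive polynomial has \<open>N\<close> distinct roots. At each of
  them \<open>u_N\<close> vanishes, so all are eigenvalues, and both polynomials are monic of degree
  \<open>N\<close>.\<close>

lemma char_poly_jacobi_mat:
  assumes c: "\<And>n. coef a x n > 0"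
  shows "char_poly (jacobi_mat a x N) = jacobi_poly (coef a x) N"
proof -
  let ?c = "coef a x"
  have pos: "(?c (Suc n))\<^sup>2 > 0" for n using c[of "Suc n"] by simp
  obtain l m where il: "interlaced N l m" and pl: "jacobi_poly ?c N = (\<Prod>i<N. [:- l i, 1:])"
    by (rule tridiag_poly_roots[OF pos])
  have inj: "inj_on l {..<N}"
    by (rule linorder_inj_onI) (use interlaced_decreasing(2)[OF il] in force)+
  have A: "jacobi_mat a x N \<in> carrier_mat N N" by (simp add: jacobi_mat_def)
  have "char_poly (jacobi_mat a x N) = (\<Prod>i<N. [:- l i, 1:])"
  proof (rule monic_eq_prod_roots[OF _ _ inj])
    show "degree (char_poly (jacobi_mat a x N)) = N" "lead_coeff (char_poly (jacobi_mat a x N)) = 1"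
      using degree_monic_char_poly[OF A] by auto
    fix i assume i: "i < N"
    have "poly (jacobi_poly ?c N) (l i) = 0"
      unfolding pl poly_prod using i by (intro prod_zero) (auto intro!: bexI[of _ i])
    moreover have "(\<Prod>i<N. ?c (Suc i)) > 0" using c by (intro prod_pos) auto
    moreover have "sol ?c (l i) (Suc N) * (\<Prod>i<N. ?c (Suc i)) = (-1) ^ N * poly (jacobi_poly ?c N) (l i)"
      by (rule sol_eq_jacobi_poly[OF c])
    ultimately have "sol ?c (l i) (Suc N) = 0"
      by (metis less_irrefl mult_eq_0_iff)
    then show "poly (char_poly (jacobi_mat a x N)) (l i) = 0"
      using sol_zero_imp_root_char_poly[OF c] i by simp
  qed
  with pl show ?thesis by simp
qed

section \<open>Sturm oscillation: eigenvalues as half-turns\<close>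

lemma sgn_minus_one_power: "sgn ((-1 :: real) ^ n) = (-1) ^ n"
  by (cases "even n") auto

text \<open>The angle advances by less than \<open>pi\<close> per step, so \<open>c\<close> and the
  integer part of \<open>\<theta> / pi\<close> each grow by 0 or 1. The sign of the sine shows that
  they jump together, a zero being counted as a completed half-turn.\<close>

lemma count_eq_floor:
  fixes \<theta> :: "nat \<Rightarrow> real" and c :: "nat \<Rightarrow> nat"
  assumes c: "c 0 = 0" "\<And>n. c n \<le> c (Suc n)" "\<And>n. c (Suc n) \<le> Suc (c n)"
    and zero: "\<And>n. sin (\<theta> (Suc n)) = 0 \<Longrightarrow> c (Suc n) = Suc (c n)"
    and sgn: "\<And>n. sin (\<theta> n) \<noteq> 0 \<Longrightarrow> sgn (sin (\<theta> n)) = (-1) ^ c n"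
    and \<theta>: "0 < \<theta> 0" "\<theta> 0 < pi" "\<And>n. \<theta> n < \<theta> (Suc n)" "\<And>n. \<theta> (Suc n) < \<theta> n + pi"
  shows "real (c n) * pi \<le> \<theta> n \<and> \<theta> n < (real (c n) + 1) * pi"
proof (induction n)
  case 0
  then show ?case using c \<theta> by simp
next
  case (Suc n)
  \<comment> \<open>The angle beyond the last counted multiple of \<open>pi\<close>. It lies
    strictly between 0 and \<open>2 * pi\<close>, so the sine tells whether it is below, at or above
    \<open>pi\<close>.\<close>
  define \<phi> where "\<phi> = \<theta> (Suc n) - real (c n) * pi"
  have \<phi>: "0 < \<phi>" "\<phi> < 2 * pi"
    using Suc \<theta>(3)[of n] \<theta>(4)[of n] by (auto simp: \<phi>_def algebra_simps)
  have eq: "\<theta> (Suc n) = \<phi> + real (c n) * pi" by (simp add: \<phi>_def)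
  have sin: "sin (\<theta> (Suc n)) = (-1) ^ c n * sin \<phi>"
    unfolding eq sin_add by (simp add: mult.commute)
  show ?case
  proof (cases "sin (\<theta> (Suc n)) = 0")
    case True
    then have "sin \<phi> = 0" using sin by simp
    then obtain k :: int where k: "\<phi> = of_int k * pi" using sin_zero_iff_int2 by blast
    have "of_int k * pi < 2 * pi" "0 < of_int k * pi" using \<phi> k by auto
    then have "k < 2" "0 < k" by (auto simp: zero_less_mult_iff mult_less_cancel_right)
    then have "k = 1" by simp
    then show ?thesis using zero[OF True] eq k by (simp add: algebra_simps)
  next
    case False
    have s: "sgn (sin (\<theta> (Suc n))) = (-1) ^ c n * sgn (sin \<phi>)"
      unfolding sin by (simp add: sgn_mult sgn_minus_one_power)
    consider "c (Suc n) = c n" | "c (Suc n) = Suc (c n)" using c(2)[of n] c(3)[of n] by linarith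
    then show ?thesis
    proof cases
      case 1
      then have "sgn (sin \<phi>) = 1" using sgn[OF False] s by simp
      then have "sin \<phi> > 0" by (simp add: sgn_1_pos)
      then have "\<phi> < pi" using \<phi> sin_le_zero[of \<phi>] by force
      then show ?thesis using 1 eq \<phi> by (simp add: algebra_simps)
    next
      case 2
      then have "sgn (sin \<phi>) = -1"
        using sgn[OF False] s by (cases "even (c n)") auto
      then have "sin \<phi> < 0" by (simp add: sgn_1_neg)
      then have "\<phi> > pi" using \<phi> sin_ge_zero[of \<phi>] by force
      then show ?thesis using 2 eq \<phi> by (simp add: algebra_simps)
    qed
  qed
qed

context small_step
begin

text \<open>The weight \<open>e * \<kappa>\<close> on the solution balances the two updates: with
  \<open>E = e\<^sup>2 * \<kappa>\<close> each becomes a shear of order \<open>e\<close>, and their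
  composition is the map in \<open>rotation_identity\<close> with
  \<open>w = \<kappa> / c n\<close>.\<close>

lemma polar_form:
  assumes c: "\<And>n. c n > 0" "\<And>n. \<kappa> / c n \<le> M" and \<kappa>: "\<kappa> > 0"
  shows "\<exists>r>0. flux c (e\<^sup>2 * \<kappa>) n = r * cos (phase e (\<lambda>n. \<kappa> / c n) n) \<and>
    e * \<kappa> * sol c (e\<^sup>2 * \<kappa>) n = r * sin (phase e (\<lambda>n. \<kappa> / c n) n)"
proof (induction n)
  case 0
  then show ?case using c(1)[of 0] by (auto simp: flux_sol_simps)
next
  case (Suc n)
  let ?t = "phase e (\<lambda>n. \<kappa> / c n) n" and ?w = "\<kappa> / c n" and ?E = "e\<^sup>2 * \<kappa>"
  obtain r where r: "r > 0" "flux c ?E n = r * cos ?t" "e * \<kappa> * sol c ?E n = r * sin ?t"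
    using Suc by blast
  have "rot_den e ?w ?t > 0" using rot_den_bounds(1)[of ?w ?t] c(1)[of n] c(2)[of n] \<kappa> by force
  then obtain s where s: "s > 0"
    "cos ?t - e * (sin ?t + e * ?w * cos ?t) = s * cos (?t + rot_step e ?w ?t)"
    "sin ?t + e * ?w * cos ?t = s * sin (?t + rot_step e ?w ?t)"
    using rotation_identity by blast
  have 1: "e * \<kappa> * sol c ?E (Suc n) = r * (sin ?t + e * ?w * cos ?t)"
    using r by (simp add: flux_sol_simps algebra_simps)
  have "?E * sol c ?E (Suc n) = e * (e * \<kappa> * sol c ?E (Suc n))" by (simp add: power2_eq_square)
  then have 2: "flux c ?E (Suc n) = r * (cos ?t - e * (sin ?t + e * ?w * cos ?t))"
    unfolding flux_sol_simps(4) 1 r(2) by (simp add: algebra_simps)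
  show ?case
    using 1 2 r(1) s by (intro exI[of _ "r * s"]) (simp add: mult_ac)
qed

text \<open>The angle is taken at \<open>Suc N\<close> because \<open>sol\<close> at
  \<open>Suc N\<close> is \<open>u_N\<close>, whose sign is that of the characteristic polynomial up
  to \<open>(-1) ^ N\<close>.\<close>

lemma eig_count_phase:
  fixes N :: nat
  assumes c: "\<And>n. coef a x n > 0" "\<And>n. \<kappa> / coef a x n \<le> M" and \<kappa>: "\<kappa> > 0"
  defines "k \<equiv> real (eig_count a x N (e\<^sup>2 * \<kappa>))"
    and "\<theta> \<equiv> phase e (\<lambda>n. \<kappa> / coef a x n) (Suc N)"
  shows "k * pi \<le> \<theta>" "\<theta> < (k + 1) * pi"
proof -
  let ?c = "coef a x" and ?E = "e\<^sup>2 * \<kappa>"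
  let ?t = "\<lambda>n. phase e (\<lambda>n. \<kappa> / ?c n) (Suc n)" and ?r = "\<lambda>n. root_count (jacobi_poly ?c n) ?E"
  have pos: "(?c (Suc n))\<^sup>2 > 0" for n using c(1)[of "Suc n"] by simp
  \<comment> \<open>All scalings are positive. The factor \<open>(-1) ^ n\<close> will cancel the
    one in \<open>root_count_tridiag_poly\<close>, leaving the parity of the count.\<close>
  have sgn_eq: "sgn (sin (?t n)) = (-1) ^ n * sgn (poly (jacobi_poly ?c n) ?E)" for n
  proof -
    obtain r where r: "r > 0" "e * \<kappa> * sol ?c ?E (Suc n) = r * sin (?t n)"
      using polar_form[of ?c \<kappa> "Suc n"] c \<kappa> by blast
    have "(\<Prod>i<n. ?c (Suc i)) > 0" using c(1) by (intro prod_pos) auto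
    then have "sgn (sol ?c ?E (Suc n)) = sgn (sol ?c ?E (Suc n) * (\<Prod>i<n. ?c (Suc i)))"
      by (simp add: sgn_mult)
    also have "\<dots> = (-1) ^ n * sgn (poly (jacobi_poly ?c n) ?E)"
      unfolding sol_eq_jacobi_poly[of ?c ?E n, OF c(1)] by (simp add: sgn_mult sgn_minus_one_power)
    also have "sgn (sol ?c ?E (Suc n)) = sgn (e * \<kappa> * sol ?c ?E (Suc n))"
      using e \<kappa> by (simp add: sgn_mult)
    also have "\<dots> = sgn (sin (?t n))" unfolding r(2) using r(1) by (simp add: sgn_mult)
    finally show ?thesis .
  qed
  have step: "0 < rot_step e (\<kappa> / ?c n) t" "rot_step e (\<kappa> / ?c n) t < pi / 2" for n t
    using rot_step_bounds[of "\<kappa> / ?c n" t] c(1)[of n] c(2)[of n] \<kappa> by auto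
  have "real (?r N) * pi \<le> ?t N \<and> ?t N < (real (?r N) + 1) * pi"
  proof (rule count_eq_floor[where c = ?r and \<theta> = ?t])
    show "?r 0 = 0" by (rule root_count_tridiag_poly(1)[OF pos])
    fix n
    show "?r n \<le> ?r (Suc n)" "?r (Suc n) \<le> Suc (?r n)"
      by (rule root_count_tridiag_poly[OF pos])+
    show "?r (Suc n) = Suc (?r n)" if "sin (?t (Suc n)) = 0"
    proof (rule root_count_tridiag_poly(4)[OF pos])
      show "poly (jacobi_poly ?c (Suc n)) ?E = 0"
        using sgn_eq[of "Suc n"] unfolding that by (simp add: sgn_zero_iff)
    qed
    show "sgn (sin (?t n)) = (-1) ^ ?r n" if "sin (?t n) \<noteq> 0"
    proof -
      have "poly (jacobi_poly ?c n) ?E \<noteq> 0"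
        using sgn_eq[of n] that by (auto simp: sgn_zero_iff)
      from root_count_tridiag_poly(5)[OF pos this]
      show ?thesis unfolding sgn_eq[of n] by (simp add: power_add flip: power_mult_distrib)
    qed
  next
    show "0 < ?t 0" "?t 0 < pi" using step[of 0 0] pi_gt_zero by simp_all
    fix n
    show "?t n < ?t (Suc n)" "?t (Suc n) < ?t n + pi"
      using step[of "Suc n" "?t n"] pi_gt_zero by simp_all
  qed
  moreover have "k = real (?r N)"
    unfolding k_def eig_count_def root_count_def char_poly_jacobi_mat[OF c(1)] ..
  ultimately show "k * pi \<le> \<theta>" "\<theta> < (k + 1) * pi" unfolding \<theta>_def by simp_all
qed

end

section \<open>The mean rotation under the doubling map\<close>

lemma periodic_of_int:
  fixes f :: "real \<Rightarrow> 'a"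
  assumes "\<And>x. f (x + 1) = f x"
  shows "f (x + of_int k) = f x"
proof (induction k rule: int_induct[where k = 0])
  case (step1 i)
  then show ?case using assms[of "x + of_int i"] by (simp add: add_ac)
next
  case (step2 i)
  then show ?case using assms[of "x + of_int (i - 1)"] by (simp add: algebra_simps)
qed simp

text \<open>An affine substitution maps the cell onto \<open>{0..1}\<close>, and periodicity absorbs
  the shift by \<open>k\<close>.\<close>

lemma integral_periodic_rescaled_cell:
  fixes f :: "real \<Rightarrow> real"
  assumes f: "continuous_on UNIV f" "\<And>x. f (x + 1) = f x" "integral {0..1} f = 0" and m: "m > 0"
  shows "((\<lambda>x. f (m * x)) has_integral 0) {real k / m..(real k + 1) / m}"
proof -
  have "(f has_integral 0) {0..1}"
    using f(1,3) by (metis continuous_on_subset has_integral_iff integrable_continuous_real top_greatest)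
  then have "((\<lambda>x. f (m *\<^sub>R x + - real k)) has_integral (1 / \<bar>m\<bar> ^ DIM(real)) *\<^sub>R 0)
      ((\<lambda>x. (1 / m) *\<^sub>R x + - ((1 / m) *\<^sub>R - real k)) ` cbox 0 1)"
    using m by (intro has_integral_affinity) auto
  moreover have "f (m *\<^sub>R x + - real k) = f (m * x)" for x
    using periodic_of_int[of f "m * x" "- int k"] f(2) by simp
  moreover have "(\<lambda>x. (1 / m) *\<^sub>R x + - ((1 / m) *\<^sub>R - real k)) ` cbox 0 1 = {real k / m..(real k + 1) / m}"
    using m image_affinity_atLeastAtMost[of "1 / m" "real k / m" 0 "1::real"]
    by (simp add: add_divide_distrib add_ac)
  ultimately show ?thesis by simp
qed

text \<open>On each of the \<open>m\<close> cells of length \<open>1 / m\<close> the fast factor has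
  mean zero, so the value of \<open>g\<close> at the left end may be subtracted. What remains of
  \<open>g\<close> is at most \<open>D\<close>, and the \<open>m\<close> contributions
  \<open>B * D / m\<close> add up to \<open>B * D\<close>.\<close>

lemma oscillatory_integral_bound:
  fixes f g :: "real \<Rightarrow> real" and m :: nat
  assumes f: "continuous_on UNIV f" "\<And>x. f (x + 1) = f x" "integral {0..1} f = 0" "\<And>x. \<bar>f x\<bar> \<le> B"
    and g: "continuous_on UNIV g" "\<And>x y. \<bar>g x - g y\<bar> \<le> D * real m * \<bar>x - y\<bar>"
    and m: "m > 0"
  shows "\<bar>integral {0..1} (\<lambda>x. f (real m * x) * g x)\<bar> \<le> B * D"
proof -
  let ?h = "\<lambda>x. f (real m * x) * g x"
  have cf: "continuous_on S (\<lambda>x. f (real m * x))" for S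
    by (rule continuous_on_compose2[OF f(1)]) (auto intro!: continuous_intros)
  have ch: "continuous_on S ?h" for S
    using cf g(1) by (intro continuous_intros) (auto intro: continuous_on_subset)
  have B: "0 \<le> B" using f(4)[of 0] by linarith
  have "\<bar>g 1 - g 0\<bar> \<le> D * real m" using g(2)[of 1 0] by simp
  then have "0 \<le> D * real m" by linarith
  then have D: "0 \<le> D" using m by (simp add: zero_le_mult_iff)
  have cell: "\<bar>integral {real k / real m..(real k + 1) / real m} ?h\<bar> \<le> B * D / real m" for k :: nat
  proof -
    let ?I = "{real k / real m..(real k + 1) / real m}"
    let ?r = "\<lambda>x. f (real m * x) * (g x - g (real k / real m))"
    have le: "real k / real m \<le> (real k + 1) / real m" using m by (simp add: divide_right_mono)
    have cr: "continuous_on ?I ?r"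
      using cf g(1) by (intro continuous_intros) (auto intro: continuous_on_subset)
    have "((\<lambda>x. f (real m * x) * g (real k / real m)) has_integral 0 * g (real k / real m)) ?I"
      using integral_periodic_rescaled_cell[OF f(1-3), of "real m" k] m
      by (intro has_integral_mult_left) auto
    moreover have "(?r has_integral integral ?I ?r) ?I"
      using cr by (intro integrable_integral integrable_continuous_real)
    ultimately have "((\<lambda>x. f (real m * x) * g (real k / real m) + ?r x) has_integral 0 * g (real k / real m) + integral ?I ?r) ?I"
      by (rule has_integral_add)
    then have "integral ?I ?h = integral ?I ?r"
      by (simp add: algebra_simps integral_unique)
    moreover have "norm (integral ?I ?r) \<le> (B * D) * ((real k + 1) / real m - real k / real m)"
    proof (rule integral_bound[OF le cr])
      show "norm (?r x) \<le> B * D" if x: "x \<in> ?I" for x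
      proof -
        from x have "\<bar>x - real k / real m\<bar> \<le> 1 / real m" by (auto simp: add_divide_distrib)
        then have "D * real m * \<bar>x - real k / real m\<bar> \<le> D * real m * (1 / real m)"
          using D by (intro mult_left_mono) auto
        then have "\<bar>g x - g (real k / real m)\<bar> \<le> D" using g(2)[of x "real k / real m"] m by simp
        then show "norm (?r x) \<le> B * D"
          unfolding real_norm_def abs_mult using f(4) B by (intro mult_mono) auto
      qed
    qed
    ultimately show ?thesis by (simp flip: diff_divide_distrib)
  qed
  have "\<bar>integral {0..real j / real m} ?h\<bar> \<le> real j * (B * D / real m)" for j :: nat
  proof (induction j)
    case (Suc j)
    have "integral {0..real j / real m} ?h + integral {real j / real m..(real j + 1) / real m} ?h
        = integral {0..(real j + 1) / real m} ?h"
      using m by (intro Henstock_Kurzweil_Integration.integral_combine integrable_continuous_real ch)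
        (auto simp: divide_right_mono)
    moreover have "real (Suc j) = real j + 1" by simp
    ultimately show ?case
      using Suc cell[of j] by (simp only: distrib_right mult_1)
  qed simp
  from this[of m] show ?thesis using m by simp
qed

section \<open>The phase as a function of the starting point\<close>

lemma lipschitz_continuous:
  fixes f :: "real \<Rightarrow> real"
  assumes "\<And>x y. \<bar>f x - f y\<bar> \<le> C * \<bar>x - y\<bar>"
  shows "continuous_on S f"
proof -
  have "0 \<le> C" using assms[of 1 0] by simp
  then have "C-lipschitz_on S f"
    using assms by (intro lipschitz_onI) (auto simp: dist_real_def)
  then show ?thesis by (rule lipschitz_on_continuous_on)
qed

text \<open>\<open>w\<close> will be \<open>\<kappa> / a\<close>. The bound \<open>small\<close>
  makes the factor \<open>80 * M\<^sup>2 * e\<close> of \<open>rot_step_lipschitz\<close> at most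
  1/2.\<close>

locale driven_phase = small_step +
  fixes w :: "real \<Rightarrow> real" and L :: real
  assumes small: "160 * M\<^sup>2 * e \<le> 1"
    and w_pos: "\<And>x. 0 < w x" and w_le: "\<And>x. w x \<le> M"
    and w_periodic: "\<And>x. w (x + 1) = w x"
    and w_lipschitz: "\<And>x y. \<bar>w x - w y\<bar> \<le> L * \<bar>x - y\<bar>"
    and w_mean: "integral {0..1} w = 1"
begin

definition ph :: "nat \<Rightarrow> real \<Rightarrow> real" where
  "ph n x = phase e (\<lambda>n. w (2 ^ n * x)) n"

lemma ph_simps: "ph 0 x = 0" "ph (Suc n) x = ph n x + rot_step e (w (2 ^ n * x)) (ph n x)"
  by (simp_all add: ph_def)

lemma L_nonneg: "0 \<le> L"
  using w_lipschitz[of 1 0] by simp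

text \<open>The constant 160 reproduces itself: the old phase contributes 160, its effect on the
  rotation at most 80 and the new weight 80, together 320, which is 160 at the next power of
  two.\<close>

lemma ph_lipschitz: "\<bar>ph n x - ph n y\<bar> \<le> 160 * M\<^sup>2 * L * e * 2 ^ n * \<bar>x - y\<bar>"
proof (induction n)
  case 0
  then show ?case using L_nonneg e M by (simp add: ph_simps)
next
  case (Suc n)
  define d where "d = M\<^sup>2 * L * e * 2 ^ n * \<bar>x - y\<bar>"
  define A where "A = 80 * M\<^sup>2 * e"
  have d: "0 \<le> d" using L_nonneg e M by (simp add: d_def)
  have A: "0 \<le> A" "A \<le> 1 / 2" using e small by (auto simp: A_def)
  have IH: "\<bar>ph n x - ph n y\<bar> \<le> 160 * d" using Suc by (simp add: d_def mult_ac)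
  have "\<bar>w (2 ^ n * x) - w (2 ^ n * y)\<bar> \<le> L * \<bar>2 ^ n * x - 2 ^ n * y\<bar>" by (rule w_lipschitz)
  also have "\<dots> = L * 2 ^ n * \<bar>x - y\<bar>" by (simp add: abs_mult flip: right_diff_distrib)
  finally have w: "\<bar>w (2 ^ n * x) - w (2 ^ n * y)\<bar> \<le> L * 2 ^ n * \<bar>x - y\<bar>" .
  have "A * \<bar>w (2 ^ n * x) - w (2 ^ n * y)\<bar> \<le> A * (L * 2 ^ n * \<bar>x - y\<bar>)"
    using w A by (intro mult_left_mono)
  also have "\<dots> = 80 * d" by (simp add: A_def d_def)
  finally have 1: "A * \<bar>w (2 ^ n * x) - w (2 ^ n * y)\<bar> \<le> 80 * d" .
  have 2: "A * \<bar>ph n x - ph n y\<bar> \<le> 1 / 2 * (160 * d)"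
    using IH A d by (intro mult_mono) auto
  have "\<bar>rot_step e (w (2 ^ n * x)) (ph n x) - rot_step e (w (2 ^ n * y)) (ph n y)\<bar>
      \<le> A * (\<bar>w (2 ^ n * x) - w (2 ^ n * y)\<bar> + \<bar>ph n x - ph n y\<bar>)"
    unfolding A_def using w_pos w_le by (intro rot_step_lipschitz) (auto intro: less_imp_le)
  then have "\<bar>rot_step e (w (2 ^ n * x)) (ph n x) - rot_step e (w (2 ^ n * y)) (ph n y)\<bar> \<le> 160 * d"
    using 1 2 by (simp add: distrib_left)
  then have "\<bar>ph (Suc n) x - ph (Suc n) y\<bar> \<le> 320 * d"
    using IH unfolding ph_simps by linarith
  then show ?case by (simp add: d_def mult_ac)
qed

lemma ph_continuous: "continuous_on S (ph n)"
  by (rule lipschitz_continuous[OF ph_lipschitz])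

lemma w_continuous: "continuous_on S w"
  by (rule lipschitz_continuous[OF w_lipschitz])

lemma ph_bounds: "0 \<le> ph n x" "ph n x \<le> n * (pi / 2)"
proof (induction n)
  case (Suc n)
  {
    case 1
    show ?case using Suc(1) rot_step_bounds(1)[OF w_pos w_le, of "2 ^ n * x" "ph n x"] by (simp add: ph_simps)
  next
    case 2
    show ?case using Suc(2) rot_step_bounds(2)[OF w_pos w_le, of "2 ^ n * x" "ph n x"]
      by (simp add: ph_simps algebra_simps)
  }
qed (simp_all add: ph_simps)

text \<open>The first term is the expansion error of one rotation. The second is the bound
  \<open>M\<close> for \<open>w - 1\<close> times twice the constant of \<open>ph_lipschitz\<close>,
  the two being the Lipschitz constant of the squared cosine.\<close>

definition err :: real where "err = 22 * M\<^sup>2 + 320 * M ^ 3 * L"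

text \<open>The mean-zero part of the weight averages out against a phase that varies only by order
  \<open>e\<close> over each of its periods; with the prefactor \<open>e\<close> the contribution is
  of order \<open>e\<^sup>2\<close>.\<close>

lemma integral_ph_step: "\<bar>integral {0..1} (\<lambda>x. ph (Suc n) x - ph n x) - e\<bar> \<le> err * e\<^sup>2"
proof -
  let ?q = "\<lambda>y. w y - 1" and ?g = "\<lambda>x. (cos (ph n x))\<^sup>2"
  let ?f = "\<lambda>x. e + e * (?q (2 ^ n * x) * ?g x)"
  let ?R = "\<lambda>x. ph (Suc n) x - ph n x - ?f x"
  have cg: "continuous_on S ?g" for S using ph_continuous by (intro continuous_intros)
  have cw: "continuous_on S (\<lambda>x. w (2 ^ n * x))" for S
    by (rule continuous_on_compose2[OF w_continuous[of UNIV]]) (auto intro!: continuous_intros)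
  have cqg: "continuous_on {0..1} (\<lambda>x. ?q (2 ^ n * x) * ?g x)"
    using ph_continuous cw by (intro continuous_intros)
  have cR: "continuous_on {0..1} ?R" using cw ph_continuous by (intro continuous_intros)
  have cf: "continuous_on {0..1} ?f" using cw ph_continuous by (intro continuous_intros)
  have osc: "\<bar>integral {0..1} (\<lambda>x. ?q (real (2 ^ n) * x) * ?g x)\<bar> \<le> M * (320 * M\<^sup>2 * L * e)"
  proof (rule oscillatory_integral_bound)
    show "continuous_on UNIV ?q" using w_continuous by (intro continuous_intros)
    show "w (x + 1) - 1 = w x - 1" for x by (simp add: w_periodic)
    show "integral {0..1} ?q = 0"
      using w_mean integrable_continuous_real[OF w_continuous] by (subst integral_diff) auto
    show "\<bar>w x - 1\<bar> \<le> M" for x using w_pos[of x] w_le[of x] M by linarith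
    show "\<bar>?g x - ?g y\<bar> \<le> 320 * M\<^sup>2 * L * e * real (2 ^ n) * \<bar>x - y\<bar>" for x y
      using cos_squared_lipschitz[of "ph n x" "ph n y"] ph_lipschitz[of n x y] by simp
  qed (use cg in simp_all)
  have "integral {0..1} ?f = e + e * integral {0..1} (\<lambda>x. ?q (2 ^ n * x) * ?g x)"
    using integrable_continuous_real[OF cqg] by (subst integral_add) (auto intro: integrable_on_mult_right)
  moreover have "\<bar>e * integral {0..1} (\<lambda>x. ?q (2 ^ n * x) * ?g x)\<bar> \<le> e * (M * (320 * M\<^sup>2 * L * e))"
    unfolding abs_mult using osc e by (intro mult_mono) auto
  ultimately have 1: "\<bar>integral {0..1} ?f - e\<bar> \<le> 320 * M ^ 3 * L * e\<^sup>2"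
    by (simp add: power2_eq_square power3_eq_cube mult_ac)
  have "norm (integral {0..1} ?R) \<le> (22 * M\<^sup>2 * e\<^sup>2) * (1 - 0)"
  proof (rule integral_bound[OF _ cR])
    show "norm (?R x) \<le> 22 * M\<^sup>2 * e\<^sup>2" for x
    proof -
      have "?R x = rot_step e (w (2 ^ n * x)) (ph n x) - e * (1 + (w (2 ^ n * x) - 1) * (cos (ph n x))\<^sup>2)"
        by (simp add: ph_simps algebra_simps)
      then show ?thesis
        using rot_step_expansion[OF less_imp_le[OF w_pos] w_le, of "2 ^ n * x" "ph n x"] by simp
    qed
  qed simp
  moreover have "integral {0..1} ?R = integral {0..1} (\<lambda>x. ph (Suc n) x - ph n x) - integral {0..1} ?f"
    using cf ph_continuous by (intro integral_diff integrable_continuous_real continuous_on_diff)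
  ultimately show ?thesis using 1 unfolding err_def by (simp add: algebra_simps)
qed

lemma integral_ph: "\<bar>integral {0..1} (ph n) - n * e\<bar> \<le> n * (err * e\<^sup>2)"
proof (induction n)
  case 0
  then show ?case by (simp add: ph_simps)
next
  case (Suc n)
  have "integral {0..1} (\<lambda>x. ph (Suc n) x - ph n x) = integral {0..1} (ph (Suc n)) - integral {0..1} (ph n)"
    using ph_continuous by (intro integral_diff integrable_continuous_real)
  then show ?case using Suc integral_ph_step[of n] by (simp add: algebra_simps)
qed

text \<open>Since the limit is the same constant for almost every point, dominated convergence makes
  it the limit of means over \<open>x\<close>, so an estimate of the mean angle suffices. The
  discrepancy of less than one half-turn between count and angle vanishes after division by
  \<open>N\<close>.\<close>

lemma limit_bound:
  assumes AE: "AE x in restrict_space lborel {0..<1}. (\<lambda>N. k N x / real N) \<longlonglongrightarrow> F"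
    and k: "\<And>N x. x \<in> {0..<1} \<Longrightarrow> k N x * pi \<le> ph (Suc N) x"
      "\<And>N x. x \<in> {0..<1} \<Longrightarrow> ph (Suc N) x < (k N x + 1) * pi"
  shows "\<bar>pi * F - e\<bar> \<le> err * e\<^sup>2"
proof -
  let ?s = "\<lambda>N x. indicat_real {0..1::real} x *\<^sub>R (ph (Suc N) x / N)"
  have conv: "(\<lambda>N. ph (Suc N) x / N) \<longlonglongrightarrow> pi * F"
    if x: "x \<in> {0..<1}" and lim: "(\<lambda>N. k N x / real N) \<longlonglongrightarrow> F" for x
  proof (rule tendsto_sandwich)
    show "(\<lambda>N. pi * (k N x / N)) \<longlonglongrightarrow> pi * F" using lim by (intro tendsto_intros)
    have "(\<lambda>N. pi * (k N x / N) + pi * (1 / N)) \<longlonglongrightarrow> pi * F + pi * 0"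
      using lim by (intro tendsto_intros lim_1_over_n)
    then show "(\<lambda>N. pi * (k N x / N) + pi * (1 / N)) \<longlonglongrightarrow> pi * F" by simp
    show "\<forall>\<^sub>F N in sequentially. pi * (k N x / N) \<le> ph (Suc N) x / N"
    proof (intro always_eventually allI)
      fix N
      have "k N x * pi / N \<le> ph (Suc N) x / N" using k(1)[OF x] by (intro divide_right_mono) auto
      then show "pi * (k N x / N) \<le> ph (Suc N) x / N" by (simp add: mult_ac)
    qed
    show "\<forall>\<^sub>F N in sequentially. ph (Suc N) x / N \<le> pi * (k N x / N) + pi * (1 / N)"
    proof (intro always_eventually allI)
      fix N
      have "ph (Suc N) x / N \<le> (k N x + 1) * pi / N"
        using less_imp_le[OF k(2)[OF x]] by (intro divide_right_mono) auto
      then show "ph (Suc N) x / N \<le> pi * (k N x / N) + pi * (1 / N)"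
        by (simp add: algebra_simps add_divide_distrib)
    qed
  qed
  have "AE x in lborel. x \<in> {0..<1} \<longrightarrow> (\<lambda>N. k N x / real N) \<longlonglongrightarrow> F"
    using AE by (subst (asm) AE_restrict_space_iff) auto
  \<comment> \<open>The density is given on \<open>{0..<1}\<close> while the integrals run over
    \<open>{0..1}\<close>; the extra endpoint is a null set.\<close>
  then have lim: "AE x in lborel. (\<lambda>N. ?s N x) \<longlonglongrightarrow> indicat_real {0..1::real} x *\<^sub>R (pi * F)"
    using AE_lborel_singleton[of 1]
  proof eventually_elim
    case (elim x)
    then show ?case using conv[of x] by (cases "x \<in> {0..<1}") (auto simp: indicator_def)
  qed
  have c: "continuous_on {0..1} (\<lambda>x. ph (Suc N) x / N)" for N
    by (cases "N = 0") (auto intro!: continuous_intros ph_continuous)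
  have int: "set_integrable lborel {0..1} (\<lambda>x. ph (Suc N) x / N)" for N
    by (rule borel_integrable_atLeastAtMost'[OF c])
  have "(\<lambda>N. integral\<^sup>L lborel (?s N)) \<longlonglongrightarrow> integral\<^sup>L lborel (\<lambda>x. indicat_real {0..1::real} x *\<^sub>R (pi * F))"
  proof (rule integral_dominated_convergence[where s = ?s and
        f = "\<lambda>x. indicat_real {0..1::real} x *\<^sub>R (pi * F)" and w = "\<lambda>x. indicat_real {0..1::real} x * pi"])
    show "integrable lborel (\<lambda>x. indicat_real {0..1::real} x * pi)" by auto
    show "AE x in lborel. norm (?s N x) \<le> indicat_real {0..1::real} x * pi" for N
    proof (intro AE_I2)
      fix x
      \<comment> \<open>For positive \<open>N\<close> the bound follows from
        \<open>Suc N \<le> 2 * N\<close>; at \<open>N = 0\<close> the quotient is 0 by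
        convention.\<close>
      have "ph (Suc N) x / N \<le> pi"
      proof (cases "N = 0")
        case False
        have "ph (Suc N) x \<le> (1 + real N) * (pi / 2)" using ph_bounds(2)[of "Suc N" x] by simp
        also have "\<dots> \<le> (2 * real N) * (pi / 2)" using False by (intro mult_right_mono) auto
        finally show ?thesis using False by (simp add: pos_divide_le_eq mult_ac)
      qed simp
      then show "norm (?s N x) \<le> indicat_real {0..1::real} x * pi"
        using ph_bounds(1)[of "Suc N" x] by (simp add: indicator_def)
    qed
    show "AE x in lborel. (\<lambda>N. ?s N x) \<longlonglongrightarrow> indicat_real {0..1::real} x *\<^sub>R (pi * F)" by (rule lim)
    show "?s N \<in> borel_measurable lborel" for N
      using int[of N] unfolding set_integrable_def by (rule borel_measurable_integrable)
  qed auto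
  moreover have "integral\<^sup>L lborel (?s N) = integral {0..1} (ph (Suc N)) / N" for N
    using set_borel_integral_eq_integral(2)[OF int[of N]] by (simp add: set_lebesgue_integral_def)
  moreover have "integral\<^sup>L lborel (\<lambda>x. indicat_real {0..1::real} x *\<^sub>R (pi * F)) = pi * F"
    by simp
  ultimately have "(\<lambda>N. integral {0..1} (ph (Suc N)) / N) \<longlonglongrightarrow> pi * F"
    by (simp only:)
  moreover have one: "(\<lambda>N. real (Suc N) / N) \<longlonglongrightarrow> 1"
    by (rule LIMSEQ_Suc_n_over_n)
  ultimately have "(\<lambda>N. \<bar>integral {0..1} (ph (Suc N)) / N - real (Suc N) / N * e\<bar>) \<longlonglongrightarrow> \<bar>pi * F - 1 * e\<bar>"
    by (intro tendsto_intros)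
  moreover have "(\<lambda>N. real (Suc N) / N * (err * e\<^sup>2)) \<longlonglongrightarrow> 1 * (err * e\<^sup>2)"
    using one by (intro tendsto_intros)
  ultimately have "\<bar>pi * F - 1 * e\<bar> \<le> 1 * (err * e\<^sup>2)"
  proof (rule LIMSEQ_le)
    show "\<exists>N. \<forall>n\<ge>N. \<bar>integral {0..1} (ph (Suc n)) / n - real (Suc n) / n * e\<bar> \<le> real (Suc n) / n * (err * e\<^sup>2)"
    proof (intro exI allI impI)
      fix n :: nat
      have "\<bar>integral {0..1} (ph (Suc n)) / n - real (Suc n) / n * e\<bar> = \<bar>integral {0..1} (ph (Suc n)) - real (Suc n) * e\<bar> / n"
        by (simp flip: diff_divide_distrib)
      also have "\<dots> \<le> (real (Suc n) * (err * e\<^sup>2)) / n"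
        using integral_ph[of "Suc n"] by (intro divide_right_mono) auto
      finally show "\<bar>integral {0..1} (ph (Suc n)) / n - real (Suc n) / n * e\<bar> \<le> real (Suc n) / n * (err * e\<^sup>2)"
        by simp
    qed
  qed
  then show ?thesis by simp
qed

end

section \<open>The density of states\<close>

text \<open>The derivative inherits periodicity, so its bound on one compact period is
  global.\<close>

lemma C1_periodic_lipschitz:
  fixes a :: "real \<Rightarrow> real"
  assumes periodic: "\<And>x. a (x + 1) = a x" and C1: "a C1_differentiable_on UNIV"
  obtains L where "\<And>x y. \<bar>a x - a y\<bar> \<le> L * \<bar>x - y\<bar>"
proof -
  obtain D where D: "\<And>x. (a has_real_derivative D x) (at x)" and cD: "continuous_on UNIV D"
    using C1 unfolding C1_differentiable_on_def has_real_derivative_iff_has_vector_derivative by auto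
  have D1: "D (x + 1) = D x" for x
  proof -
    have "((\<lambda>x. a (x + 1)) has_real_derivative D (x + 1)) (at x)"
      using D[of "x + 1"] by (simp only: DERIV_shift)
    then show ?thesis unfolding periodic using D[of x] by (rule DERIV_unique)
  qed
  have "bounded (D ` {0..1})"
    by (intro compact_imp_bounded compact_continuous_image continuous_on_subset[OF cD]) auto
  then obtain L where "\<forall>y\<in>D ` {0..1}. \<bar>y\<bar> \<le> L"
    unfolding bounded_iff real_norm_def ..
  then have L: "\<bar>D x\<bar> \<le> L" if "x \<in> {0..1}" for x
    using that by blast
  have "\<bar>D x\<bar> \<le> L" for x
  proof -
    have "D x = D (frac x + of_int \<lfloor>x\<rfloor>)" by (simp add: frac_def)
    also have "\<dots> = D (frac x)" using D1 by (rule periodic_of_int[of D])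
    finally show ?thesis using L[of "frac x"] frac_ge_0[of x] frac_lt_1[of x] by simp
  qed
  then have "\<bar>a x - a y\<bar> \<le> L * \<bar>x - y\<bar>" for x y
    using D by (intro lipschitz_of_deriv_bound[of a D L]) auto
  with that show ?thesis by blast
qed

theorem theorem1p2:
  fixes a F :: "real \<Rightarrow> real" and \<kappa> :: real
  assumes periodic: "\<And>x. a (x + 1) = a x"
    and C1: "a C1_differentiable_on UNIV"
    and inf_pos: "0 < (INF x. a x)"
    and nonconst: "(INF x. a x) < (SUP x. a x)"
    and bounded: "bdd_above (range a)"
    and IDS: "is_IDS a F"
    and kappa: "\<kappa> = inverse (integral {0..1} (\<lambda>x. inverse (a x)))"
  shows "(\<lambda>E. F E - 1 / (pi * sqrt \<kappa>) * sqrt E) \<in> O[at_right 0](\<lambda>E. E * \<bar>ln E\<bar>)"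
proof -
  obtain K where K: "\<And>x y. \<bar>a x - a y\<bar> \<le> K * \<bar>x - y\<bar>"
    using C1_periodic_lipschitz[OF periodic C1] by blast
  have ca: "continuous_on S a" for S
    by (rule lipschitz_continuous[OF K])
  define m where "m = (INF x. a x)"
  define S where "S = (SUP x. a x)"
  have m: "0 < m" using inf_pos by (simp add: m_def)
  \<comment> \<open>A real \<open>INF\<close> is known to be a lower bound only for families bounded
    below; compactness of one period provides this.\<close>
  have "compact (a ` {0..1})" by (intro compact_continuous_image ca) auto
  then have "bounded (a ` {0..1})" by (rule compact_imp_bounded)
  moreover have "range a \<subseteq> a ` {0..1}"
  proof
    fix y assume "y \<in> range a"
    then obtain x where "y = a x" by blast
    moreover have "a x = a (frac x)"
      using periodic_of_int[of a "frac x" "\<lfloor>x\<rfloor>", OF periodic] by (simp add: frac_def)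
    ultimately show "y \<in> a ` {0..1}"
      using frac_ge_0[of x] frac_lt_1[of x] by (intro image_eqI[of _ _ "frac x"]) auto
  qed
  ultimately have "bdd_below (range a)" by (meson bounded_imp_bdd_below bounded_subset)
  then have a_ge: "m \<le> a x" for x unfolding m_def by (intro cINF_lower) auto
  have a_le: "a x \<le> S" for x unfolding S_def using bounded by (intro cSUP_upper) auto
  have a_pos: "0 < a x" for x using a_ge[of x] m by linarith
  have S: "0 < S" using a_pos[of 0] a_le[of 0] by linarith
  \<comment> \<open>Periodicity removes \<open>frac\<close>, so the orbit can be followed as
    \<open>2 ^ n * x\<close> on the real line, where the phase is continuous in
    \<open>x\<close>.\<close>
  have coef: "coef a x n = a (2 ^ n * x)" for x n
    using periodic_of_int[of a "frac (2 ^ n * x)" "\<lfloor>2 ^ n * x\<rfloor>", OF periodic]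
    by (simp add: coef_def frac_def)
  have ci: "continuous_on {0..1} (\<lambda>x. inverse (a x))"
    using ca a_pos by (intro continuous_intros) (auto intro: less_imp_neq[symmetric] simp: less_le)
  define I where "I = integral {0..1} (\<lambda>x. inverse (a x))"
  have "integral {0..1} (\<lambda>x::real. inverse S) \<le> I"
    unfolding I_def
    by (intro integral_le integrable_continuous_real ci) (use a_le a_pos in \<open>auto intro: le_imp_inverse_le\<close>)
  then have I: "0 < I" using S by (simp add: less_le_trans[of 0 "inverse S"])
  have \<kappa>: "0 < \<kappa>" "\<kappa> = inverse I" using I kappa by (auto simp: I_def)
  define w where "w x = \<kappa> / a x" for x
  \<comment> \<open>\<open>\<kappa> / m\<close> bounds the weight, and the maximum with 1 provides
    \<open>1 \<le> M\<close> at once. \<open>L\<close> comes from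
    \<open>a x * a y \<ge> m\<^sup>2\<close> in the difference of reciprocals.\<close>
  define M where "M = max 1 (\<kappa> / m)"
  define L where "L = \<kappa> * K / m\<^sup>2"
  define C where "C = 22 * M\<^sup>2 + 320 * M ^ 3 * L"
  have w: "0 < w x" "w x \<le> M" for x
  proof -
    have "w x \<le> \<kappa> / m" unfolding w_def using a_ge[of x] m \<kappa> by (intro divide_left_mono) auto
    then show "w x \<le> M" by (simp add: M_def)
  qed (use a_pos \<kappa> in \<open>simp add: w_def\<close>)
  have w_lipschitz: "\<bar>w x - w y\<bar> \<le> L * \<bar>x - y\<bar>" for x y
  proof -
    have "w x - w y = \<kappa> * (a y - a x) / (a x * a y)"
      using a_pos[of x] a_pos[of y] by (simp add: w_def field_simps)
    then have "\<bar>w x - w y\<bar> = \<kappa> * \<bar>a x - a y\<bar> / (a x * a y)"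
      using a_pos[of x] a_pos[of y] \<kappa> by (simp add: abs_mult abs_minus_commute)
    also have "\<dots> \<le> \<kappa> * (K * \<bar>x - y\<bar>) / (m * m)"
      using a_ge m \<kappa> K[of x y] by (intro frac_le mult_mono mult_left_mono) (auto intro: order_trans[of 0 m])
    finally show ?thesis by (simp add: L_def power2_eq_square)
  qed
  have w_mean: "integral {0..1} w = 1"
  proof -
    have "integral {0..1} w = \<kappa> * I"
      unfolding I_def w_def divide_inverse by (rule integral_mult_right)
    then show ?thesis using I \<kappa> by simp
  qed
  \<comment> \<open>The leading term is \<open>e / pi\<close> with
    \<open>e\<^sup>2 = E / \<kappa>\<close>, so the error is linear in \<open>E\<close>, without a
    logarithm.\<close>
  have main: "\<bar>F E - 1 / (pi * sqrt \<kappa>) * sqrt E\<bar> \<le> C / (pi * \<kappa>) * E"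
    if E: "0 < E" "160 * M\<^sup>2 * sqrt (E / \<kappa>) \<le> 1" for E
  proof -
    define e where "e = sqrt (E / \<kappa>)"
    have e_pos: "0 < e" and eE: "e\<^sup>2 * \<kappa> = E" and e_small: "160 * M\<^sup>2 * e \<le> 1"
      using E \<kappa> by (auto simp: e_def)
    have M1: "1 \<le> M" by (simp add: M_def)
    then have "M * 1 \<le> M * M" by (intro mult_left_mono) auto
    then have "M * e \<le> M\<^sup>2 * e" using e_pos by (intro mult_right_mono) (auto simp: power2_eq_square)
    moreover have "0 < M\<^sup>2 * e" using e_pos M1 by simp
    ultimately have "4 * M * e \<le> 1" using e_small by linarith
    then interpret driven_phase M e w L
      by unfold_locales (use M1 e_pos e_small w w_lipschitz w_mean periodic in \<open>auto simp: w_def\<close>)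
    have wc: "(\<lambda>n. w (2 ^ n * x)) = (\<lambda>n. \<kappa> / coef a x n)" for x
      by (simp add: w_def coef)
    have "\<bar>pi * F E - e\<bar> \<le> err * e\<^sup>2"
    proof (rule limit_bound)
      show "AE x in restrict_space lborel {0..<1}. (\<lambda>N. real (eig_count a x N E) / real N) \<longlonglongrightarrow> F E"
        using IDS by (simp add: is_IDS_def)
      fix N and x :: real
      have "coef a x n > 0" "\<kappa> / coef a x n \<le> M" for n
        using a_pos w(2)[of "2 ^ n * x"] by (auto simp: coef w_def)
      from eig_count_phase[OF this \<kappa>(1), of N, unfolded eE]
      show "real (eig_count a x N E) * pi \<le> ph (Suc N) x"
        "ph (Suc N) x < (real (eig_count a x N E) + 1) * pi"
        unfolding ph_def wc by simp_all
    qed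
    then have "\<bar>pi * F E - e\<bar> \<le> C * e\<^sup>2" by (simp add: C_def err_def)
    moreover have "F E - 1 / (pi * sqrt \<kappa>) * sqrt E = (pi * F E - e) / pi"
      by (simp add: e_def real_sqrt_divide field_simps)
    ultimately have "\<bar>F E - 1 / (pi * sqrt \<kappa>) * sqrt E\<bar> \<le> C * e\<^sup>2 / pi"
      by (simp add: abs_divide divide_right_mono)
    also have "e\<^sup>2 = E / \<kappa>" using E \<kappa> by (simp add: e_def)
    finally show ?thesis by (simp add: mult_ac)
  qed
  have small: "\<forall>\<^sub>F E in at_right 0. 160 * M\<^sup>2 * sqrt (E / \<kappa>) < 1"
  proof (rule order_tendstoD)
    have "((\<lambda>E. 160 * M\<^sup>2 * sqrt (E / \<kappa>)) \<longlongrightarrow> 160 * M\<^sup>2 * sqrt (0 / \<kappa>)) (at_right 0)"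
      using \<kappa> by (intro tendsto_intros) auto
    then show "((\<lambda>E. 160 * M\<^sup>2 * sqrt (E / \<kappa>)) \<longlongrightarrow> 0) (at_right 0)" by simp
  qed simp
  \<comment> \<open>Below \<open>exp (-1)\<close> the modulus of \<open>ln E\<close> is at least 1,
    so the linear bound implies the stated one.\<close>
  have "\<forall>\<^sub>F E in at_right 0. E < exp (-1 :: real)"
    by (rule order_tendstoD(2)[OF tendsto_ident_at]) simp
  then have "\<forall>\<^sub>F E in at_right 0. norm (F E - 1 / (pi * sqrt \<kappa>) * sqrt E)
      \<le> \<bar>C / (pi * \<kappa>)\<bar> * norm (E * \<bar>ln E\<bar>)"
    using small eventually_at_right_less[of 0]
  proof eventually_elim
    case (elim E)
    have "ln E < ln (exp (-1))" using elim by (subst ln_less_cancel_iff) auto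
    then have ln: "1 \<le> \<bar>ln E\<bar>" by simp
    have "norm (F E - 1 / (pi * sqrt \<kappa>) * sqrt E) \<le> C / (pi * \<kappa>) * E"
      using main[of E] elim by simp
    also have "\<dots> \<le> \<bar>C / (pi * \<kappa>)\<bar> * E"
      using elim by (intro mult_right_mono abs_ge_self) auto
    also have "\<dots> \<le> \<bar>C / (pi * \<kappa>)\<bar> * norm (E * \<bar>ln E\<bar>)"
      using elim ln mult_left_mono[of 1 "\<bar>ln E\<bar>" E] by (intro mult_left_mono) (auto simp: abs_mult)
    finally show ?case .
  qed
  then show ?thesis by (rule bigoI)
qed

end
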